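(* Every compact ultrametric space $X$ can be extended to a compact ultraextensive ultrametric space $Y$ (i.e. $X\subseteq Y$ and $d_Y\restriction X=d_X$). In particular, every compact ultrametric space $X$ has a compact ultrametric S-extension, i.e. there is a compact ultrametric space $Y$ extending $X$ and a map $\phi:\mathcal{P}_X\to\mathrm{Iso}(Y)$ such that $\phi(p)$ extends $p$ for all $p\in\mathcal{P}_X$.
   Context: A partial isometry of a metric space $X$ is an isometry between two finite subsets of $X$; $\mathcal{P}_X$ denotes the set of partial isometries of $X$ which are not restrictions of the identity. For a finite metric space $X$, an S-extension of $X$ is a pair $(Y,\phi)$ with $Y$ a metric space extending $X$ and $\phi:\mathcal{P}_X\to\mathrm{Iso}(Y)$ with $\phi(p)\restriction\mathrm{dom}(p)=p$; assuming $\phi(p^{-1})=\phi(p)^{-1}$, $\phi$ is extended to a homomorphism from the free group $\mathbb{F}(\mathcal{P}_X)$ to $\mathrm{Iso}(Y)$. $(Y,\phi)$ is minimal if every $y\in Y$ equals $\phi(g)(x)$ for some $g\in\mathbb{F}(\mathcal{P}_X)$, $x\in X$. For finite $X_1\subseteq X_2$ and S-extensions $(Y_i,\phi_i)$ of $X_i$, they are coherent if $Y_2$ extends $Y_1$, $\phi_2(p)$ extends $\phi_1(p)$ for all $p\in\mathcal{P}_{X_1}$, and the assignment $\phi_1(p)\mapsto\phi_2(p)$ extends uniquely to an injective group homomorphism $\phi_1(\mathbb{F}(\mathcal{P}_{X_1}))\to\phi_2(\mathbb{F}(\mathcal{P}_{X_2}))$. A metric space $U$ is ultraextensive if: (i)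 every partial isometry of $U$ extends to an isometry of $U$; (ii) every finite $X\subseteq U$ has a finite S-extension $(Y,\phi)$ with $Y\subseteq U$; (iii) whenever $X_1\subseteq X_2\subseteq U$ are finite and $(Y_1,\phi_1)$ is a finite minimal S-extension of $X_1$ with $Y_1\subseteq U$, there is a finite minimal S-extension $(Y_2,\phi_2)$ of $X_2$ with $Y_2\subseteq U$ coherent with $(Y_1,\phi_1)$. *)

theory Defs
  imports "HOL-Analysis.Abstract_Metric_Spaces" "HOL-Algebra.Bij"
begin

section \<open>Metric spaces, isometries and partial isometries\<close>

locale Ultrametric_space = Metric_space +
  assumes ultrametric:
    "\<And>x y z. \<lbrakk>x \<in> M; y \<in> M; z \<in> M\<rbrakk> \<Longrightarrow> d x z \<le> max (d x y) (d y z)"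

definition compact_ultrametric :: "'a set \<Rightarrow> ('a \<Rightarrow> 'a \<Rightarrow> real) \<Rightarrow> bool" where
  "compact_ultrametric X d \<longleftrightarrow>
     Ultrametric_space X d \<and> compact_space (Metric_space.mtopology X d)"

text \<open>\<open>Y\<close> extends \<open>X\<close>, where \<open>X\<close> is identified with its image under \<open>e\<close>.
  For literal inclusions \<open>e\<close> is \<open>\<lambda>x. x\<close>.\<close>

definition metric_extension ::
  "('a \<Rightarrow> 'b) \<Rightarrow> 'a set \<Rightarrow> ('a \<Rightarrow> 'a \<Rightarrow> real) \<Rightarrow> 'b set \<Rightarrow> ('b \<Rightarrow> 'b \<Rightarrow> real) \<Rightarrow> bool" where
  "metric_extension e X d Y d' \<longleftrightarrow>
     Metric_space X d \<and> Metric_space Y d' \<and> e ` X \<subseteq> Y \<and>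
     (\<forall>x\<in>X. \<forall>y\<in>X. d' (e x) (e y) = d x y)"

text \<open>Isometries of a space onto itself, as extensional functions under composition.\<close>

definition Iso :: "'a set \<Rightarrow> ('a \<Rightarrow> 'a \<Rightarrow> real) \<Rightarrow> ('a \<Rightarrow> 'a) monoid" where
  "Iso Y d = BijGroup Y
     \<lparr>carrier := {f \<in> Bij Y. \<forall>x\<in>Y. \<forall>y\<in>Y. d (f x) (f y) = d x y}\<rparr>"

text \<open>A partial isometry is represented by its graph, so that its inverse is the converse
  relation; \<open>p \<subseteq> Id\<close> means that \<open>p\<close> is a restriction of the identity.\<close>

definition partial_isometries :: "'a set \<Rightarrow> ('a \<Rightarrow> 'a \<Rightarrow> real) \<Rightarrow> ('a \<times> 'a) set set" where
  "partial_isometries X d =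
     {p. finite p \<and> p \<subseteq> X \<times> X \<and> single_valued p \<and>
         (\<forall>(x, x')\<in>p. \<forall>(y, y')\<in>p. d x' y' = d x y)}"

definition PP :: "'a set \<Rightarrow> ('a \<Rightarrow> 'a \<Rightarrow> real) \<Rightarrow> ('a \<times> 'a) set set" where
  "PP X d = {p \<in> partial_isometries X d. \<not> p \<subseteq> Id}"

section \<open>Free groups\<close>

text \<open>A letter \<open>(True, s)\<close> stands for the generator \<open>s\<close>, and \<open>(False, s)\<close> for its
  inverse. The elements of the free group are the reduced words.\<close>

type_synonym 's letter = "bool \<times> 's"

definition inv_letter :: "'s letter \<Rightarrow> 's letter" where
  "inv_letter a = (\<not> fst a, snd a)"

definition reduced :: "'s letter list \<Rightarrow> bool" where
  "reduced = successively (\<lambda>a b. b \<noteq> inv_letter a)"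

fun push :: "'s letter \<Rightarrow> 's letter list \<Rightarrow> 's letter list" where
  "push a [] = [a]"
| "push a (b # w) = (if b = inv_letter a then w else a # b # w)"

definition free_group :: "'s set \<Rightarrow> 's letter list monoid" where
  "free_group S =
     \<lparr>carrier = {w. snd ` set w \<subseteq> S \<and> reduced w}, mult = (\<lambda>v w. foldr push v w), one = []\<rparr>"

definition letter_val :: "('g, 'm) monoid_scheme \<Rightarrow> ('s \<Rightarrow> 'g) \<Rightarrow> 's letter \<Rightarrow> 'g" where
  "letter_val G \<phi> a = (if fst a then \<phi> (snd a) else inv\<^bsub>G\<^esub> \<phi> (snd a))"

text \<open>The homomorphic extension of \<open>\<phi>\<close> to the free group
  (see \<open>free_ext_hom\<close> and \<open>free_ext_generator\<close> below).\<close>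

definition free_ext :: "('g, 'm) monoid_scheme \<Rightarrow> ('s \<Rightarrow> 'g) \<Rightarrow> 's letter list \<Rightarrow> 'g" where
  "free_ext G \<phi> w = foldr (\<lambda>a g. letter_val G \<phi> a \<otimes>\<^bsub>G\<^esub> g) w \<one>\<^bsub>G\<^esub>"

section \<open>S-extensions\<close>

definition S_extension ::
  "('a \<Rightarrow> 'b) \<Rightarrow> 'a set \<Rightarrow> ('a \<Rightarrow> 'a \<Rightarrow> real) \<Rightarrow> 'b set \<Rightarrow> ('b \<Rightarrow> 'b \<Rightarrow> real) \<Rightarrow>
   (('a \<times> 'a) set \<Rightarrow> 'b \<Rightarrow> 'b) \<Rightarrow> bool" where
  "S_extension e X d Y d' \<phi> \<longleftrightarrow>
     metric_extension e X d Y d' \<and> \<phi> \<in> PP X d \<rightarrow> carrier (Iso Y d') \<and>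
     (\<forall>p\<in>PP X d. \<forall>(x, y)\<in>p. \<phi> p (e x) = e y)"

definition inverse_compatible ::
  "'a set \<Rightarrow> 'a set \<Rightarrow> ('a \<Rightarrow> 'a \<Rightarrow> real) \<Rightarrow> (('a \<times> 'a) set \<Rightarrow> 'a \<Rightarrow> 'a) \<Rightarrow> bool" where
  "inverse_compatible X Y d \<phi> \<longleftrightarrow> (\<forall>p\<in>PP X d. \<phi> (p\<inverse>) = inv\<^bsub>Iso Y d\<^esub> \<phi> p)"

text \<open>The convention \<open>\<phi> (p\<inverse>) = inv (\<phi> p)\<close> is in force wherever \<open>\<phi>\<close> is extended to the
  free group; it is therefore part of minimality.\<close>

definition minimal_S_extension ::
  "'a set \<Rightarrow> 'a set \<Rightarrow> ('a \<Rightarrow> 'a \<Rightarrow> real) \<Rightarrow> (('a \<times> 'a) set \<Rightarrow> 'a \<Rightarrow> 'a) \<Rightarrow> bool" where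
  "minimal_S_extension X Y d \<phi> \<longleftrightarrow>
     S_extension (\<lambda>x. x) X d Y d \<phi> \<and> inverse_compatible X Y d \<phi> \<and>
     (\<forall>y\<in>Y. \<exists>g\<in>carrier (free_group (PP X d)). \<exists>x\<in>X. y = free_ext (Iso Y d) \<phi> g x)"

definition free_image ::
  "'a set \<Rightarrow> 'a set \<Rightarrow> ('a \<Rightarrow> 'a \<Rightarrow> real) \<Rightarrow> (('a \<times> 'a) set \<Rightarrow> 'a \<Rightarrow> 'a) \<Rightarrow> ('a \<Rightarrow> 'a) monoid" where
  "free_image X Y d \<phi> =
     (Iso Y d) \<lparr>carrier := free_ext (Iso Y d) \<phi> ` carrier (free_group (PP X d))\<rparr>"

text \<open>Both extensions live in one ambient metric space with metric \<open>d\<close>.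
  The homomorphism is required to be extensional so that its uniqueness is not affected
  by values outside its domain.\<close>

definition coherent ::
  "'a set \<Rightarrow> 'a set \<Rightarrow> (('a \<times> 'a) set \<Rightarrow> 'a \<Rightarrow> 'a) \<Rightarrow>
   'a set \<Rightarrow> 'a set \<Rightarrow> (('a \<times> 'a) set \<Rightarrow> 'a \<Rightarrow> 'a) \<Rightarrow> ('a \<Rightarrow> 'a \<Rightarrow> real) \<Rightarrow> bool" where
  "coherent X1 Y1 \<phi>1 X2 Y2 \<phi>2 d \<longleftrightarrow>
     Y1 \<subseteq> Y2 \<and>
     (\<forall>p\<in>PP X1 d. \<forall>y\<in>Y1. \<phi>2 p y = \<phi>1 p y) \<and>
     (\<exists>!h. h \<in> extensional (carrier (free_image X1 Y1 d \<phi>1)) \<and>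
           h \<in> mon (free_image X1 Y1 d \<phi>1) (free_image X2 Y2 d \<phi>2) \<and>
           (\<forall>p\<in>PP X1 d. h (\<phi>1 p) = \<phi>2 p))"

definition ultraextensive :: "'a set \<Rightarrow> ('a \<Rightarrow> 'a \<Rightarrow> real) \<Rightarrow> bool" where
  "ultraextensive U d \<longleftrightarrow>
     Metric_space U d \<and>
     (\<forall>p\<in>partial_isometries U d. \<exists>f\<in>carrier (Iso U d). \<forall>(x, y)\<in>p. f x = y) \<and>
     (\<forall>X. finite X \<and> X \<subseteq> U \<longrightarrow>
        (\<exists>Y \<phi>. finite Y \<and> Y \<subseteq> U \<and> S_extension (\<lambda>x. x) X d Y d \<phi>)) \<and>
     (\<forall>X1 X2 Y1 \<phi>1.
        X1 \<subseteq> X2 \<and> X2 \<subseteq> U \<and> finite X2 \<and>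
        finite Y1 \<and> Y1 \<subseteq> U \<and> minimal_S_extension X1 Y1 d \<phi>1 \<longrightarrow>
        (\<exists>Y2 \<phi>2. finite Y2 \<and> Y2 \<subseteq> U \<and> minimal_S_extension X2 Y2 d \<phi>2 \<and>
                 coherent X1 Y1 \<phi>1 X2 Y2 \<phi>2 d))"

section \<open>Validation of the encodings\<close>

lemma inv_letter_inv_letter [simp]: "inv_letter (inv_letter a) = a"
  by (simp add: inv_letter_def)

lemma snd_inv_letter [simp]: "snd (inv_letter a) = snd a"
  by (simp add: inv_letter_def)

lemma reduced_Nil [simp]: "reduced []"
  by (simp add: reduced_def)

lemma reduced_Cons: "reduced (a # w) \<longleftrightarrow> w = [] \<or> hd w \<noteq> inv_letter a \<and> reduced w"
  by (simp add: reduced_def successively_Cons)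

lemma reduced_push: "reduced w \<Longrightarrow> reduced (push a w)"
  by (cases w) (auto simp: reduced_Cons)

lemma push_inv_push: "reduced w \<Longrightarrow> push (inv_letter a) (push a w) = w"
  by (cases w; cases "tl w") (auto simp: reduced_Cons)

lemma reduced_foldr_push: "reduced w \<Longrightarrow> reduced (foldr push v w)"
  by (induction v) (auto intro: reduced_push)

lemma set_push: "snd ` set (push a w) \<subseteq> insert (snd a) (snd ` set w)"
  by (cases w) auto

lemma set_foldr_push: "snd ` set (foldr push v w) \<subseteq> snd ` set v \<union> snd ` set w"
proof (induction v)
  case (Cons a v)
  then show ?case using set_push[of a "foldr push v w"] by (simp del: image_subset_iff) blast
qed auto

lemma foldr_push_push:
  assumes "reduced v" "reduced w"
  shows "foldr push (push a v) w = push a (foldr push v w)"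
proof (cases v)
  case (Cons b u)
  then show ?thesis
    using push_inv_push[OF reduced_foldr_push[OF assms(2), of u], of "inv_letter a"] by auto
qed auto

lemma foldr_push_assoc:
  assumes "reduced v" "reduced w"
  shows "foldr push (foldr push u v) w = foldr push u (foldr push v w)"
  by (induction u) (simp_all add: foldr_push_push reduced_foldr_push assms)

lemma foldr_push_Nil: "reduced w \<Longrightarrow> foldr push w [] = w"
proof (induction w)
  case (Cons a w)
  then show ?case by (cases w) (auto simp: reduced_Cons)
qed auto

lemma foldr_push_rev_inv:
  "reduced w \<Longrightarrow> foldr push (rev (map inv_letter v)) (foldr push v w) = w"
  by (induction v) (simp_all add: push_inv_push reduced_foldr_push)

lemma group_free_group: "group (free_group S)"
proof (rule groupI)
  fix x assume x: "x \<in> carrier (free_group S)"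
  let ?y = "foldr push (rev (map inv_letter x)) []"
  have "reduced ?y" "snd ` set ?y \<subseteq> S"
    using x set_foldr_push[of "rev (map inv_letter x)" "[]"] reduced_foldr_push[of "[]"]
    by (auto simp: free_group_def image_image)
  moreover have "foldr push ?y x = []"
    using x foldr_push_assoc[of "[]" x] foldr_push_rev_inv[of "[]" x]
    by (simp add: free_group_def foldr_push_Nil)
  ultimately show "\<exists>y\<in>carrier (free_group S). y \<otimes>\<^bsub>free_group S\<^esub> x = \<one>\<^bsub>free_group S\<^esub>"
    by (auto simp: free_group_def)
next
  fix x y assume "x \<in> carrier (free_group S)" "y \<in> carrier (free_group S)"
  then show "x \<otimes>\<^bsub>free_group S\<^esub> y \<in> carrier (free_group S)"
    using order_trans[OF set_foldr_push[of x y]] by (simp add: free_group_def reduced_foldr_push)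
qed (auto simp: free_group_def foldr_push_assoc)

context group
begin

lemma letter_val_closed: "\<phi> (snd a) \<in> carrier G \<Longrightarrow> letter_val G \<phi> a \<in> carrier G"
  by (simp add: letter_val_def)

lemma free_ext_closed: "\<phi> ` snd ` set w \<subseteq> carrier G \<Longrightarrow> free_ext G \<phi> w \<in> carrier G"
  by (induction w) (auto simp: free_ext_def letter_val_closed)

lemma free_ext_push:
  assumes "\<phi> ` snd ` set (a # w) \<subseteq> carrier G"
  shows "free_ext G \<phi> (push a w) = letter_val G \<phi> a \<otimes> free_ext G \<phi> w"
proof (cases w)
  case (Cons b u)
  have "letter_val G \<phi> a \<otimes> (letter_val G \<phi> (inv_letter a) \<otimes> free_ext G \<phi> u) = free_ext G \<phi> u"
    using assms free_ext_closed[of \<phi> u] Cons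
    by (simp add: letter_val_def inv_letter_def m_assoc[symmetric])
  then show ?thesis using Cons by (auto simp: free_ext_def)
qed (simp add: free_ext_def)

lemma free_ext_hom:
  assumes "\<phi> \<in> S \<rightarrow> carrier G"
  shows "free_ext G \<phi> \<in> hom (free_group S) G"
proof (rule homI)
  fix w assume "w \<in> carrier (free_group S)"
  then show "free_ext G \<phi> w \<in> carrier G"
    using assms by (intro free_ext_closed) (auto simp: free_group_def)
next
  fix v w assume vw: "v \<in> carrier (free_group S)" "w \<in> carrier (free_group S)"
  have "free_ext G \<phi> (foldr push v w) = free_ext G \<phi> v \<otimes> free_ext G \<phi> w"
    if "snd ` set v \<subseteq> S" using that
  proof (induction v)
    case Nil
    then show ?case
      using free_ext_closed[of \<phi> w] assms vw by (force simp: free_group_def free_ext_def)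
  next
    case (Cons a v)
    have *: "\<phi> ` snd ` set u \<subseteq> carrier G" if "snd ` set u \<subseteq> S" for u :: "'c letter list"
      using that assms by auto
    have w: "snd ` set w \<subseteq> S" using vw by (simp add: free_group_def)
    have "snd ` set (a # foldr push v w) \<subseteq> S"
      using Cons.prems order_trans[OF set_foldr_push[of v w], of S] w by simp
    then have "free_ext G \<phi> (push a (foldr push v w)) =
        letter_val G \<phi> a \<otimes> (free_ext G \<phi> v \<otimes> free_ext G \<phi> w)"
      using Cons by (subst free_ext_push[OF *]) auto
    also have "\<dots> = (letter_val G \<phi> a \<otimes> free_ext G \<phi> v) \<otimes> free_ext G \<phi> w"
      using Cons.prems w assms
      by (intro m_assoc[symmetric] letter_val_closed free_ext_closed *) auto
    finally show ?case by (simp add: free_ext_def)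
  qed
  then show "free_ext G \<phi> (v \<otimes>\<^bsub>free_group S\<^esub> w) = free_ext G \<phi> v \<otimes> free_ext G \<phi> w"
    using vw by (simp add: free_group_def)
qed

lemma free_ext_generator: "\<phi> s \<in> carrier G \<Longrightarrow> free_ext G \<phi> [(True, s)] = \<phi> s"
  by (simp add: free_ext_def letter_val_def)

end

lemma group_Iso: "group (Iso Y d)"
proof -
  interpret B: group "BijGroup Y" by (rule group_BijGroup)
  let ?C = "{f \<in> Bij Y. \<forall>x\<in>Y. \<forall>y\<in>Y. d (f x) (f y) = d x y}"
  have "subgroup ?C (BijGroup Y)"
  proof (rule B.subgroupI)
    have "(\<lambda>x\<in>Y. x) \<in> ?C" using id_Bij[of Y] by auto
    then show "?C \<noteq> {}" by blast
    show "?C \<subseteq> carrier (BijGroup Y)" by (auto simp: BijGroup_def)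
  next
    fix f assume f: "f \<in> ?C"
    let ?g = "\<lambda>x\<in>Y. inv_into Y f x"
    have g: "inv\<^bsub>BijGroup Y\<^esub> f = ?g"
      using f by (simp add: inv_BijGroup)
    have Y: "inv_into Y f x \<in> Y" "f (inv_into Y f x) = x" if "x \<in> Y" for x
      using f that by (auto simp: Bij_def bij_betw_def inv_into_into f_inv_into_f)
    have "d (?g x) (?g y) = d x y" if "x \<in> Y" "y \<in> Y" for x y
      using f that Y(1)[OF that(1)] Y(1)[OF that(2)] Y(2)[OF that(1)] Y(2)[OF that(2)]
      by (auto simp: restrict_def) metis
    then show "inv\<^bsub>BijGroup Y\<^esub> f \<in> ?C"
      using f restrict_inv_into_Bij[of f Y] unfolding g by blast
  next
    fix f g assume "f \<in> ?C" "g \<in> ?C"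
    moreover from this have "g x \<in> Y" if "x \<in> Y" for x
      using that Bij_imp_funcset[of g Y] by auto
    ultimately show "f \<otimes>\<^bsub>BijGroup Y\<^esub> g \<in> ?C"
      by (auto simp: BijGroup_def compose_Bij) (simp add: compose_def)
  qed
  then show ?thesis
    unfolding Iso_def by (rule B.subgroup_imp_group)
qed

end

theory Submission
  imports Defs
begin

text \<open>
  The nonzero distances of a compact ultrametric space \<open>X\<close> form a set \<open>D\<close> with only finitely many
  elements above each positive bound, and for each \<open>t \<in> D\<close> there are only finitely many open
  \<open>t\<close>-balls, say \<open>k t\<close>. Numbering the open \<open>t\<close>-balls gives each point a coordinate below \<open>k t\<close>, and
  this embeds \<open>X\<close> isometrically into the compact product \<open>Y\<close> of the sets \<open>{..<k t}\<close>, where two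
  points are at the distance of the largest index at which they differ. All balls of a given radius
  in \<open>Y\<close> split in the same way.

  A finite partial isometry \<open>p\<close> of \<open>Y\<close> acts on the tree of balls as a partial injection at each
  branching. Completing these injections to permutations by a rule which respects composition gives
  an isometry \<open>E p\<close> of \<open>Y\<close> extending \<open>p\<close> with \<open>E (p O q) = E q \<circ> E p\<close> whenever \<open>p\<close> and \<open>q\<close> are
  composable. Rounding to a finite set of representatives of small balls gives the same on a finite
  \<open>B \<subseteq> Y\<close> containing any prescribed finite set. Given a minimal S-extension \<open>(Y\<^sub>1, \<phi>\<^sub>1)\<close> of
  \<open>X\<^sub>1 \<subseteq> X\<^sub>2\<close>, take \<open>B \<supseteq> Y\<^sub>1 \<union> X\<^sub>2\<close>, let \<open>p\<close> act on \<open>B\<close> by \<open>E (\<phi>\<^sub>1 p)\<close> if \<open>p\<close> is a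
  partial isometry of \<open>X\<^sub>1\<close> and by \<open>E p\<close> otherwise, and restrict to the orbit of \<open>X\<^sub>2\<close>: since
  \<open>E\<close> is a homomorphism on the isometries of \<open>Y\<^sub>1\<close>, every relation between the \<open>\<phi>\<^sub>1 p\<close> is preserved.
\<close>

section \<open>Extending partial injections of a finite set functorially\<close>

text \<open>Routing every bijection between finite sets of equal size through one fixed enumeration of
  each set makes the chosen bijections compatible with composition.\<close>

definition label :: "'a set \<Rightarrow> 'a \<Rightarrow> nat" where
  "label T = (SOME h. bij_betw h T {0..<card T})"

definition transport :: "'a set \<Rightarrow> 'a set \<Rightarrow> 'a \<Rightarrow> 'a" where
  "transport S T x = inv_into T (label T) (label S x)"

lemma bij_betw_label: "finite T \<Longrightarrow> bij_betw (label T) T {0..<card T}"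
  unfolding label_def by (rule someI_ex[OF ex_bij_betw_finite_nat])

lemma label_transport:
  assumes "finite S" "finite T" "card S = card T" "x \<in> S"
  shows "transport S T x \<in> T" "label T (transport S T x) = label S x"
proof -
  have "label S x \<in> label T ` T"
    using assms bij_betw_label[OF assms(1)] bij_betw_label[OF assms(2)] by (auto simp: bij_betw_def)
  then show "transport S T x \<in> T" "label T (transport S T x) = label S x"
    by (auto simp: transport_def inv_into_into f_inv_into_f)
qed

lemma transport_comp:
  assumes "finite S" "finite T" "card S = card T" "x \<in> S"
  shows "transport T U (transport S T x) = transport S U x"
  using label_transport(2)[OF assms] by (simp add: transport_def)

lemma transport_self: "finite S \<Longrightarrow> x \<in> S \<Longrightarrow> transport S S x = x"
  using bij_betw_label[of S] by (simp add: transport_def bij_betw_def)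

definition partial_injection :: "nat \<Rightarrow> (nat \<times> nat) set \<Rightarrow> bool" where
  "partial_injection k R \<longleftrightarrow>
     R \<subseteq> {..<k} \<times> {..<k} \<and> single_valued R \<and> single_valued (R\<inverse>)"

text \<open>Off the domain the value depends only on \<open>Domain R\<close> and
  \<open>Range R\<close>, not on how \<open>R\<close> pairs them; this is what lets completions
  compose.\<close>

definition extend_perm :: "nat \<Rightarrow> (nat \<times> nat) set \<Rightarrow> nat \<Rightarrow> nat" where
  "extend_perm k R i =
     (if i \<in> Domain R then THE j. (i, j) \<in> R
      else transport ({..<k} - Domain R) ({..<k} - Range R) i)"

lemma partial_injection_converse: "partial_injection k R \<Longrightarrow> partial_injection k (R\<inverse>)"
  by (auto simp: partial_injection_def)

lemma card_codomains:
  assumes "partial_injection k R"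
  shows "card ({..<k} - Domain R) = card ({..<k} - Range R)"
proof -
  have R: "inj_on fst R" "inj_on snd R" and sub: "Domain R \<subseteq> {..<k}" "Range R \<subseteq> {..<k}"
    using assms by (auto simp: partial_injection_def single_valued_def inj_on_def)
  have "card (Domain R) = card (Range R)"
    using card_image[OF R(1)] card_image[OF R(2)] by (simp add: Domain_fst Range_snd)
  then show ?thesis
    using sub by (simp add: card_Diff_subset finite_subset[OF _ finite_lessThan])
qed

lemma extend_perm_in: "partial_injection k R \<Longrightarrow> (i, j) \<in> R \<Longrightarrow> extend_perm k R i = j"
  by (auto simp: extend_perm_def partial_injection_def single_valued_def intro!: the_equality)

lemma extend_perm_notin:
  assumes "partial_injection k R" "i < k" "i \<notin> Domain R"
  shows "extend_perm k R i < k" "extend_perm k R i \<notin> Range R"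
  using label_transport(1)[OF _ _ card_codomains[OF assms(1)], of i] assms
  by (auto simp: extend_perm_def)

lemma extend_perm_less:
  assumes "partial_injection k R" "i < k"
  shows "extend_perm k R i < k"
proof (cases "i \<in> Domain R")
  case True
  then obtain j where "(i, j) \<in> R" by auto
  then show ?thesis using extend_perm_in[OF assms(1)] assms by (auto simp: partial_injection_def)
qed (simp add: extend_perm_notin assms)

lemma extend_perm_Id_on: "i < k \<Longrightarrow> extend_perm k (Id_on S) i = i"
  using transport_self[of "{..<k} - S" i] by (auto simp: extend_perm_def Domain_Id_on)

text \<open>With \<open>Range R = Domain Q\<close> the points missed by the range of
  \<open>R\<close> are those missed by the domain of \<open>Q\<close>, so the two transports chain
  into one; inside the domains the pairs themselves chain.\<close>

lemma extend_perm_relcomp: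
  assumes R: "partial_injection k R" and Q: "partial_injection k Q"
    and RQ: "Range R = Domain Q" and i: "i < k"
  shows "extend_perm k (R O Q) i = extend_perm k Q (extend_perm k R i)"
proof -
  have comp: "partial_injection k (R O Q)"
    using R Q unfolding partial_injection_def
    by (auto simp: converse_relcomp intro!: single_valued_relcomp)
  have dom: "Domain (R O Q) = Domain R" and ran: "Range (R O Q) = Range Q"
    using RQ by blast+
  show ?thesis
  proof (cases "i \<in> Domain R")
    case True
    then obtain j l where "(i, j) \<in> R" "(j, l) \<in> Q" using RQ by blast
    then show ?thesis
      using extend_perm_in[OF R] extend_perm_in[OF Q] extend_perm_in[OF comp] by blast
  next
    case False
    with extend_perm_notin[OF R i] show ?thesis
      using transport_comp[OF _ _ card_codomains[OF R], of i] i False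
      by (simp add: extend_perm_def dom ran RQ)
  qed
qed

lemma partial_injection_inverse:
  assumes "partial_injection k R" shows "R O R\<inverse> = Id_on (Domain R)"
  using assms
  by (simp add: set_eq_iff Id_on_iff relcomp_unfold partial_injection_def single_valued_def Domain_iff)
    blast

lemma extend_perm_inverse:
  assumes R: "partial_injection k R" and i: "i < k"
  shows "extend_perm k (R\<inverse>) (extend_perm k R i) = i"
  using extend_perm_relcomp[OF R partial_injection_converse[OF R] _ i] i
  by (simp add: partial_injection_inverse[OF R] extend_perm_Id_on)

section \<open>Coordinates\<close>

text \<open>Coordinates are indexed by the radii \<open>t \<in> D\<close> themselves; the coordinate at \<open>t\<close> selects an
  open \<open>t\<close>-ball inside a closed one. Values outside \<open>D\<close> are fixed to \<open>0\<close>.\<close>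

definition cube :: "real set \<Rightarrow> (real \<Rightarrow> nat) \<Rightarrow> (real \<Rightarrow> nat) set" where
  "cube D k = {f. \<forall>t. (t \<in> D \<longrightarrow> f t < k t) \<and> (t \<notin> D \<longrightarrow> f t = 0)}"

text \<open>Indices are radii, so the largest index of disagreement is itself the distance.
  \<open>insert 0\<close> keeps the supremum over a nonempty set when the points are equal.\<close>

definition cube_dist :: "(real \<Rightarrow> nat) \<Rightarrow> (real \<Rightarrow> nat) \<Rightarrow> real" where
  "cube_dist f g = Sup (insert 0 {t. f t \<noteq> g t})"

lemma cube_dist_commute: "cube_dist f g = cube_dist g f"
  by (simp add: cube_dist_def eq_commute)

lemma cube_dist_self [simp]: "cube_dist f f = 0"
  by (simp add: cube_dist_def)

locale radii =
  fixes D :: "real set"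
  assumes pos: "t \<in> D \<Longrightarrow> 0 < t"
    and fin: "0 < e \<Longrightarrow> finite (D \<inter> {e..})"
begin

lemma diff_subset: "f \<in> cube D k \<Longrightarrow> g \<in> cube D k \<Longrightarrow> {t. f t \<noteq> g t} \<subseteq> D"
  by (force simp: cube_def)

lemma bdd_above_diff:
  assumes "f \<in> cube D k" "g \<in> cube D k"
  shows "bdd_above {t. f t \<noteq> g t}"
proof -
  have "bdd_above (D \<inter> {1..})" using fin[of 1] by (intro bdd_above_finite) simp
  then have "bdd_above (D \<inter> {1..} \<union> {..1})" by simp
  then show ?thesis
    by (rule bdd_above_mono) (use diff_subset[OF assms] in force)
qed

lemma cube_dist_le_iff:
  assumes "f \<in> cube D k" "g \<in> cube D k" "0 \<le> s"
  shows "cube_dist f g \<le> s \<longleftrightarrow> (\<forall>t>s. f t = g t)"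
  unfolding cube_dist_def using assms bdd_above_diff[OF assms(1,2)]
  by (subst cSup_le_iff) (auto simp: not_le[symmetric])

lemma cube_dist_ge:
  assumes "f \<in> cube D k" "g \<in> cube D k" "f t \<noteq> g t"
  shows "t \<le> cube_dist f g"
  unfolding cube_dist_def using assms bdd_above_diff[OF assms(1,2)]
  by (intro cSup_upper) auto

text \<open>Only finitely many radii lie above a given index of disagreement, so the supremum is a
  maximum.\<close>

lemma cube_dist_attained:
  assumes "f \<in> cube D k" "g \<in> cube D k" "f \<noteq> g"
  shows "f (cube_dist f g) \<noteq> g (cube_dist f g)"
proof -
  let ?S = "{t. f t \<noteq> g t}"
  obtain e where e: "e \<in> ?S" using assms(3) by auto
  then have e_pos: "0 < e" using diff_subset[OF assms(1,2)] pos by blast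
  let ?F = "?S \<inter> {e..}"
  have F: "finite ?F" by (rule finite_subset[OF _ fin[OF e_pos]]) (use diff_subset[OF assms(1,2)] in auto)
  have m: "Max ?F \<in> ?F" using F e by (intro Max_in) auto
  have "cube_dist f g = Max ?F" unfolding cube_dist_def
  proof (rule cSup_eq_maximum)
    show "Max ?F \<in> insert 0 ?S" using m by blast
    fix t assume "t \<in> insert 0 ?S"
    then show "t \<le> Max ?F"
      using Max_ge[OF F, of t] m e_pos by (cases "e \<le> t") auto
  qed
  then show ?thesis using m by simp
qed

lemma cube_dist_in:
  "f \<in> cube D k \<Longrightarrow> g \<in> cube D k \<Longrightarrow> f \<noteq> g \<Longrightarrow> cube_dist f g \<in> D"
  using cube_dist_attained diff_subset by blast

lemma cube_dist_nonneg: "f \<in> cube D k \<Longrightarrow> g \<in> cube D k \<Longrightarrow> 0 \<le> cube_dist f g"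
  using cube_dist_in[of f k g] pos by (cases "f = g") force+

lemma cube_dist_less_iff:
  assumes "f \<in> cube D k" "g \<in> cube D k" "0 < s"
  shows "cube_dist f g < s \<longleftrightarrow> (\<forall>t\<ge>s. f t = g t)"
proof
  show "\<forall>t\<ge>s. f t = g t" if "cube_dist f g < s"
    using cube_dist_ge[OF assms(1,2)] that by force
  show "cube_dist f g < s" if "\<forall>t\<ge>s. f t = g t"
    using cube_dist_attained[OF assms(1,2)] assms(3) that by (cases "f = g") (force simp: not_le[symmetric])+
qed

lemma cube_dist_triangle:
  assumes "f \<in> cube D k" "g \<in> cube D k" "h \<in> cube D k"
  shows "cube_dist f h \<le> max (cube_dist f g) (cube_dist g h)"
proof -
  let ?m = "max (cube_dist f g) (cube_dist g h)"
  have "0 \<le> ?m" using cube_dist_nonneg[OF assms(1,2)] by simp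
  then have "\<forall>t>?m. f t = g t" "\<forall>t>?m. g t = h t"
    using cube_dist_le_iff[OF assms(1,2), of ?m] cube_dist_le_iff[OF assms(2,3), of ?m] by simp_all
  then show ?thesis using cube_dist_le_iff[OF assms(1,3) \<open>0 \<le> ?m\<close>] by simp
qed

end

text \<open>Points are reached through a bijection \<open>c\<close> rather than being coordinate
  functions, because the final \<open>Y\<close> has to contain a copy of \<open>X\<close>. The value
  0 off \<open>Y\<close> gives nonnegativity and symmetry for all arguments, as
  \<open>Metric_space\<close> demands.\<close>

locale coordinates = radii D for D :: "real set" +
  fixes k :: "real \<Rightarrow> nat" and Y :: "'b set" and d :: "'b \<Rightarrow> 'b \<Rightarrow> real"
    and c :: "'b \<Rightarrow> real \<Rightarrow> nat"
  assumes bij: "bij_betw c Y (cube D k)"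
    and d_def: "d x y = (if x \<in> Y \<and> y \<in> Y then cube_dist (c x) (c y) else 0)"
begin

lemma in_cube [simp]: "x \<in> Y \<Longrightarrow> c x \<in> cube D k"
  using bij by (auto simp: bij_betw_def)

lemma c_eq_iff: "x \<in> Y \<Longrightarrow> y \<in> Y \<Longrightarrow> c x = c y \<longleftrightarrow> x = y"
  using bij by (auto simp: bij_betw_def inj_on_def)

lemma c_inverse: "f \<in> cube D k \<Longrightarrow> c (inv_into Y c f) = f" "f \<in> cube D k \<Longrightarrow> inv_into Y c f \<in> Y"
  using bij by (auto simp: bij_betw_def f_inv_into_f inv_into_into)

lemma d_le_iff: "x \<in> Y \<Longrightarrow> y \<in> Y \<Longrightarrow> 0 \<le> s \<Longrightarrow> d x y \<le> s \<longleftrightarrow> (\<forall>t>s. c x t = c y t)"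
  by (simp add: d_def cube_dist_le_iff[of _ k])

lemma d_less_iff: "x \<in> Y \<Longrightarrow> y \<in> Y \<Longrightarrow> 0 < s \<Longrightarrow> d x y < s \<longleftrightarrow> (\<forall>t\<ge>s. c x t = c y t)"
  by (simp add: d_def cube_dist_less_iff[of _ k])

lemma d_in: "x \<in> Y \<Longrightarrow> y \<in> Y \<Longrightarrow> x \<noteq> y \<Longrightarrow> d x y \<in> D"
  by (simp add: d_def cube_dist_in[of _ k] c_eq_iff)

lemma d_attained: "x \<in> Y \<Longrightarrow> y \<in> Y \<Longrightarrow> x \<noteq> y \<Longrightarrow> c x (d x y) \<noteq> c y (d x y)"
  by (simp add: d_def cube_dist_attained[of _ k] c_eq_iff)

sublocale Ultrametric_space Y d
proof
  show "0 \<le> d x y" for x y by (auto simp: d_def intro: cube_dist_nonneg[of _ k])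
  show "d x y = d y x" for x y by (auto simp: d_def cube_dist_commute)
  show "d x y = 0 \<longleftrightarrow> x = y" if "x \<in> Y" "y \<in> Y" for x y
    using d_in[OF that] pos[of "d x y"] d_def[of y y] by (cases "x = y") auto
  show ultra: "d x z \<le> max (d x y) (d y z)" if "x \<in> Y" "y \<in> Y" "z \<in> Y" for x y z
    using cube_dist_triangle[of "c x" k "c y" "c z"] that by (simp add: d_def)
  show "d x z \<le> d x y + d y z" if "x \<in> Y" "y \<in> Y" "z \<in> Y" for x y z
    using ultra[OF that] \<open>\<And>x y. 0 \<le> d x y\<close>[of x y] \<open>\<And>x y. 0 \<le> d x y\<close>[of y z] by simp
qed

text \<open>Erasing the coordinates below \<open>e\<close> moves a point by less than
  \<open>e\<close>; finitely many coordinates survive, each with finitely many values, so the erased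
  points form a finite net.\<close>

lemma totally_bounded: "mtotally_bounded Y"
  unfolding mtotally_bounded_def
proof (intro allI impI)
  fix e :: real assume e: "0 < e"
  define T where "T = {f \<in> cube D k. \<forall>t. t < e \<longrightarrow> f t = 0}"
  have "finite T"
  proof (rule finite_subset)
    let ?B = "{..Max (k ` (D \<inter> {e..}))}"
    show "T \<subseteq> {f. \<forall>t. (t \<in> D \<inter> {e..} \<longrightarrow> f t \<in> ?B) \<and> (t \<notin> D \<inter> {e..} \<longrightarrow> f t = 0)}"
    proof (intro subsetI CollectI allI conjI impI)
      fix f t assume "f \<in> T" "t \<in> D \<inter> {e..}"
      then have "f t \<le> Max (k ` (D \<inter> {e..}))"
        using fin[OF e] by (subst Max_ge_iff) (auto simp: T_def cube_def intro!: bexI[of _ t] less_imp_le)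
      then show "f t \<in> ?B" by simp
    qed (auto simp: T_def cube_def)
    show "finite \<dots>" by (rule finite_set_of_finite_funs) (use fin[OF e] in auto)
  qed
  show "\<exists>K. finite K \<and> K \<subseteq> Y \<and> Y \<subseteq> (\<Union>x\<in>K. mball x e)"
  proof (intro exI[of _ "inv_into Y c ` T"] conjI subsetI)
    show "finite (inv_into Y c ` T)" using \<open>finite T\<close> by simp
    show "x \<in> Y" if "x \<in> inv_into Y c ` T" for x using that c_inverse by (auto simp: T_def)
    fix y assume y: "y \<in> Y"
    define f where "f t = (if t < e then 0 else c y t)" for t
    have f: "f \<in> T" using in_cube[OF y] by (auto simp: f_def T_def cube_def)
    then have "f \<in> cube D k" by (simp add: T_def)
    then have "d (inv_into Y c f) y < e" using y e by (simp add: d_less_iff c_inverse f_def)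
    then show "y \<in> (\<Union>x\<in>inv_into Y c ` T. mball x e)"
      using f y c_inverse(2)[OF \<open>f \<in> cube D k\<close>] by auto
  qed
qed

text \<open>Along a Cauchy sequence all coordinates from any positive index upwards are eventually
  constant, so the limit can be read off coordinate by coordinate.\<close>

lemma complete: "mcomplete"
  unfolding mcomplete_def
proof (intro allI impI)
  fix s assume s: "MCauchy s"
  then have sY: "s n \<in> Y" for n by (auto simp: MCauchy_def)
  have "\<exists>N. \<forall>n\<ge>N. \<forall>n'\<ge>N. \<forall>t\<ge>e. c (s n) t = c (s n') t" if "0 < e" for e
    using s that sY unfolding MCauchy_def by (simp add: d_less_iff)
  then obtain N where N: "\<And>e n n' t. 0 < e \<Longrightarrow> n \<ge> N e \<Longrightarrow> n' \<ge> N e \<Longrightarrow> t \<ge> e \<Longrightarrow> c (s n) t = c (s n') t"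
    by metis
  \<comment> \<open>For \<open>0 < t\<close> the coordinate at \<open>t\<close> is constant from
    stage \<open>N t\<close> on; for other \<open>t\<close> it is 0 at every stage.\<close>
  define f where "f t = c (s (N t)) t" for t
  have f: "f \<in> cube D k" using in_cube[OF sY] unfolding f_def cube_def by simp
  have "c (s n) t = f t" if "0 < e" "n \<ge> N e" "t \<ge> e" for e n t
    using N[of e n "max (N e) (N t)" t] N[of t "N t" "max (N e) (N t)" t] that by (simp add: f_def)
  then have "limitin mtopology s (inv_into Y c f) sequentially"
    unfolding limitin_metric eventually_sequentially
    by (auto simp: sY d_less_iff c_inverse[OF f])
  then show "\<exists>x. limitin mtopology s x sequentially" by blast
qed

lemma compact_ultrametric: "compact_ultrametric Y d"
  unfolding compact_ultrametric_def
  using Ultrametric_space_axioms complete totally_bounded compact_space_eq_mcomplete_mtotally_bounded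
  by blast

end

section \<open>Partial isometries\<close>

lemma partial_isometries_iff:
  "p \<in> partial_isometries X d \<longleftrightarrow>
     finite p \<and> p \<subseteq> X \<times> X \<and> single_valued p \<and>
     (\<forall>a b a' b'. (a, b) \<in> p \<longrightarrow> (a', b') \<in> p \<longrightarrow> d b b' = d a a')"
  unfolding partial_isometries_def by blast

lemma partial_isometry_mem:
  "p \<in> partial_isometries X d \<Longrightarrow> (a, b) \<in> p \<Longrightarrow> a \<in> X \<and> b \<in> X"
  unfolding partial_isometries_iff by blast

lemma partial_isometry_dist:
  "p \<in> partial_isometries X d \<Longrightarrow> (a, b) \<in> p \<Longrightarrow> (a', b') \<in> p \<Longrightarrow> d b b' = d a a'"
  unfolding partial_isometries_iff by blast

lemma single_valued_partial_isometry_converse: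
  assumes "Metric_space X d" "p \<in> partial_isometries X d"
  shows "single_valued (p\<inverse>)"
proof (rule single_valuedI)
  fix x y z assume "(x, y) \<in> p\<inverse>" "(x, z) \<in> p\<inverse>"
  then have "d x x = d y z" "y \<in> X" "z \<in> X" "x \<in> X"
    using partial_isometry_dist[OF assms(2), of y x z x] partial_isometry_mem[OF assms(2)] by auto
  then show "y = z" using Metric_space.zero[OF assms(1)] by metis
qed

lemma partial_isometries_converse:
  assumes "Metric_space X d" "p \<in> partial_isometries X d"
  shows "p\<inverse> \<in> partial_isometries X d"
  unfolding partial_isometries_iff
proof (intro conjI allI impI)
  show "d b b' = d a a'" if "(a, b) \<in> p\<inverse>" "(a', b') \<in> p\<inverse>" for a b a' b'
    using partial_isometry_dist[OF assms(2), of b a b' a'] that by simp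
  show "p\<inverse> \<subseteq> X \<times> X" using partial_isometry_mem[OF assms(2)] by auto
  show "finite (p\<inverse>)" using assms(2) by (simp add: partial_isometries_iff)
qed (rule single_valued_partial_isometry_converse[OF assms])

lemma partial_isometries_relcomp:
  assumes p: "p \<in> partial_isometries X d" and q: "q \<in> partial_isometries X d"
  shows "p O q \<in> partial_isometries X d"
  unfolding partial_isometries_iff
proof (intro conjI allI impI)
  show "d c c' = d a a'" if "(a, c) \<in> p O q" "(a', c') \<in> p O q" for a c a' c'
  proof -
    obtain b b' where "(a, b) \<in> p" "(b, c) \<in> q" "(a', b') \<in> p" "(b', c') \<in> q"
      using \<open>(a, c) \<in> p O q\<close> \<open>(a', c') \<in> p O q\<close> by blast
    then show ?thesis using partial_isometry_dist[OF p] partial_isometry_dist[OF q] by metis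
  qed
  show "p O q \<subseteq> X \<times> X" using partial_isometry_mem[OF p] partial_isometry_mem[OF q] by blast
  show "finite (p O q)" "single_valued (p O q)"
    using p q by (auto simp: partial_isometries_iff intro: single_valued_relcomp)
qed

lemma partial_isometries_Id_on:
  "finite A \<Longrightarrow> A \<subseteq> X \<Longrightarrow> Id_on A \<in> partial_isometries X d"
  using finite_subset[OF Id_on_subset_Times, of A]
  by (auto simp: partial_isometries_iff Id_on_iff single_valued_def)

lemma partial_isometries_mono: "X \<subseteq> Y \<Longrightarrow> partial_isometries X d \<subseteq> partial_isometries Y d"
  by (rule subsetI) (unfold partial_isometries_iff, blast)

lemma converse_relcomp_partial_isometry:
  "p \<in> partial_isometries X d \<Longrightarrow> p\<inverse> O p = Id_on (Range p)"
  unfolding partial_isometries_iff single_valued_def by (auto simp: Id_on_iff)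

lemma Iso_iff:
  "f \<in> carrier (Iso Y d) \<longleftrightarrow>
     f \<in> extensional Y \<and> bij_betw f Y Y \<and> (\<forall>x\<in>Y. \<forall>y\<in>Y. d (f x) (f y) = d x y)"
  by (auto simp: Iso_def Bij_def)

lemma Iso_one: "\<one>\<^bsub>Iso Y d\<^esub> = (\<lambda>y\<in>Y. y)"
  by (simp add: Iso_def BijGroup_def)

lemma Iso_mult_apply:
  "f \<in> carrier (Iso Y d) \<Longrightarrow> g \<in> carrier (Iso Y d) \<Longrightarrow> y \<in> Y \<Longrightarrow>
     (f \<otimes>\<^bsub>Iso Y d\<^esub> g) y = f (g y)"
  by (simp add: Iso_def BijGroup_def compose_def)

lemma Iso_eqI:
  "f \<in> carrier (Iso Y d) \<Longrightarrow> g \<in> carrier (Iso Y d) \<Longrightarrow> (\<And>y. y \<in> Y \<Longrightarrow> f y = g y) \<Longrightarrow> f = g"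
  by (auto simp: Iso_iff intro: extensionalityI)

lemma Iso_closed: "f \<in> carrier (Iso Y d) \<Longrightarrow> y \<in> Y \<Longrightarrow> f y \<in> Y"
  by (auto simp: Iso_iff bij_betw_def)

lemma Iso_finiteI:
  assumes "Metric_space Y d" "finite Y" "f \<in> extensional Y" "f ` Y \<subseteq> Y"
    and iso: "\<And>x y. x \<in> Y \<Longrightarrow> y \<in> Y \<Longrightarrow> d (f x) (f y) = d x y"
  shows "f \<in> carrier (Iso Y d)"
proof -
  have "inj_on f Y"
  proof (rule inj_onI)
    fix x y assume *: "x \<in> Y" "y \<in> Y" "f x = f y"
    then have "d x y = d (f x) (f x)" "f x \<in> Y" using iso[of x y] assms(4) by auto
    then show "x = y" using * Metric_space.zero[OF assms(1)] by metis
  qed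
  then show ?thesis
    using assms endo_inj_surj[of Y f] by (simp add: Iso_iff bij_betw_def)
qed

section \<open>The canonical extension of a partial isometry\<close>

context coordinates
begin

text \<open>The effect of \<open>p\<close> on those open \<open>t\<close>-balls inside the closed \<open>t\<close>-ball around \<open>y\<close> that
  contain a point of the domain. It is empty if there is no such point; then \<open>ext p\<close> leaves the
  coordinate at \<open>t\<close> unchanged.\<close>

definition branch :: "('b \<times> 'b) set \<Rightarrow> real \<Rightarrow> 'b \<Rightarrow> (nat \<times> nat) set" where
  "branch p t y = {(c a t, c b t) | a b. (a, b) \<in> p \<and> d a y \<le> t}"

text \<open>The coordinates of \<open>y\<close> above \<open>t\<close> determine its closed
  \<open>t\<close>-ball and with it \<open>branch p t y\<close>, so each new coordinate depends only
  on the old ones from \<open>t\<close> upwards, as for a tree automorphism.\<close>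

definition ext :: "('b \<times> 'b) set \<Rightarrow> 'b \<Rightarrow> 'b" where
  "ext p y =
     inv_into Y c (\<lambda>t. if t \<in> D then extend_perm (k t) (branch p t y) (c y t) else 0)"

lemma branchI: "(a, b) \<in> p \<Longrightarrow> d a y \<le> t \<Longrightarrow> (c a t, c b t) \<in> branch p t y"
  unfolding branch_def by blast

abbreviation "PI \<equiv> partial_isometries Y d"

lemma PI_mem: "p \<in> PI \<Longrightarrow> (a, b) \<in> p \<Longrightarrow> a \<in> Y \<and> b \<in> Y"
  by (rule partial_isometry_mem)

lemma PI_dist: "p \<in> PI \<Longrightarrow> (a, b) \<in> p \<Longrightarrow> (a', b') \<in> p \<Longrightarrow> d b b' = d a a'"
  by (rule partial_isometry_dist)

lemma c_less: "y \<in> Y \<Longrightarrow> t \<in> D \<Longrightarrow> c y t < k t"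
  using in_cube by (auto simp: cube_def)

lemma c_notin: "y \<in> Y \<Longrightarrow> t \<notin> D \<Longrightarrow> c y t = 0"
  using in_cube by (auto simp: cube_def)

lemma d_ge: "x \<in> Y \<Longrightarrow> y \<in> Y \<Longrightarrow> c x t \<noteq> c y t \<Longrightarrow> t \<le> d x y"
  using cube_dist_ge[of "c x" k "c y" t] by (simp add: d_def)

lemma same_coordinate_iff:
  assumes "x \<in> Y" "y \<in> Y" "t \<in> D" "d x y \<le> t"
  shows "c x t = c y t \<longleftrightarrow> d x y \<noteq> t"
proof (cases "x = y")
  case True
  then show ?thesis using assms pos[of t] by auto
next
  case False
  then show ?thesis using assms d_ge[of x y t] d_attained[of x y] by force
qed

lemma ball_le:
  "x \<in> Y \<Longrightarrow> y \<in> Y \<Longrightarrow> z \<in> Y \<Longrightarrow> d x y \<le> t \<Longrightarrow> d z y \<le> t \<Longrightarrow> d x z \<le> t"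
  using ultrametric[of x y z] commute[of z y] by simp

text \<open>Every point of a closed ultrametric ball is a centre of it.\<close>

lemma branch_cong:
  assumes "p \<in> PI" "y \<in> Y" "z \<in> Y" "d y z \<le> t"
  shows "branch p t y = branch p t z"
proof -
  have "d a y \<le> t \<longleftrightarrow> d a z \<le> t" if "a \<in> Y" for a
    using ball_le[of a y z t] ball_le[of a z y t] that assms commute[of y z] by auto
  then show ?thesis unfolding branch_def using PI_mem[OF assms(1)] by blast
qed

text \<open>Inside a closed \<open>t\<close>-ball, differing at coordinate \<open>t\<close> means
  being at distance exactly \<open>t\<close>, which \<open>p\<close> preserves. One direction makes
  \<open>branch\<close> single-valued, the other its converse.\<close>

lemma branch_iff:
  assumes p: "p \<in> PI" "y \<in> Y" "t \<in> D"
    and ab: "(a, b) \<in> p" "(a', b') \<in> p" "d a y \<le> t" "d a' y \<le> t"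
  shows "c a t = c a' t \<longleftrightarrow> c b t = c b' t"
proof -
  have Y: "a \<in> Y" "b \<in> Y" "a' \<in> Y" "b' \<in> Y" using PI_mem p(1) ab by auto
  have "d a a' \<le> t" using ball_le[of a y a'] Y p ab by simp
  then show ?thesis
    using same_coordinate_iff Y p(3) PI_dist[OF p(1) ab(1,2)] by simp
qed

lemma branch_partial_injection:
  assumes p: "p \<in> PI" "y \<in> Y" "t \<in> D"
  shows "partial_injection (k t) (branch p t y)"
  unfolding partial_injection_def
proof (intro conjI single_valuedI)
  show "branch p t y \<subseteq> {..<k t} \<times> {..<k t}"
    using PI_mem[OF p(1)] c_less[OF _ p(3)] by (auto simp: branch_def)
  show "u = v" if "(s, u) \<in> branch p t y" "(s, v) \<in> branch p t y" for s u v
    using that branch_iff[OF p] by (auto simp: branch_def)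
  show "u = v" if "(s, u) \<in> (branch p t y)\<inverse>" "(s, v) \<in> (branch p t y)\<inverse>" for s u v
    using that branch_iff[OF p] by (auto simp: branch_def)
qed

lemma ext_cube:
  assumes "p \<in> PI" "y \<in> Y"
  shows "(\<lambda>t. if t \<in> D then extend_perm (k t) (branch p t y) (c y t) else 0) \<in> cube D k"
  using branch_partial_injection[OF assms] c_less[OF assms(2)] by (simp add: cube_def extend_perm_less)

lemma ext_in: "p \<in> PI \<Longrightarrow> y \<in> Y \<Longrightarrow> ext p y \<in> Y"
  unfolding ext_def by (rule c_inverse(2)) (rule ext_cube)

lemma c_ext:
  "p \<in> PI \<Longrightarrow> y \<in> Y \<Longrightarrow>
     c (ext p y) t = (if t \<in> D then extend_perm (k t) (branch p t y) (c y t) else 0)"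
  unfolding ext_def by (subst c_inverse(1)[OF ext_cube]) auto

lemma point_eqI:
  "x \<in> Y \<Longrightarrow> y \<in> Y \<Longrightarrow> (\<And>t. t \<in> D \<Longrightarrow> c x t = c y t) \<Longrightarrow> x = y"
  using c_notin by (metis c_eq_iff ext)

lemma ext_extends:
  assumes "p \<in> PI" "(a, b) \<in> p"
  shows "ext p a = b"
proof (rule point_eqI)
  have ab: "a \<in> Y" "b \<in> Y" using PI_mem assms by auto
  then show "ext p a \<in> Y" "b \<in> Y" using ext_in assms by auto
  fix t assume t: "t \<in> D"
  have "(c a t, c b t) \<in> branch p t a"
    using assms ab pos[OF t] by (intro branchI) auto
  then show "c (ext p a) t = c b t"
    using extend_perm_in[OF branch_partial_injection[OF assms(1) ab(1) t]] c_ext assms ab t by simp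
qed

text \<open>Two points share the permutation used at every radius from their distance upwards. Above
  the distance they also share coordinates, so the images agree there; at the distance, injectivity
  of the permutation keeps the coordinates different.\<close>

lemma ext_isometry:
  assumes p: "p \<in> PI" and yz: "y \<in> Y" "z \<in> Y"
  shows "d (ext p y) (ext p z) = d y z"
proof (cases "y = z")
  case True
  then show ?thesis using yz ext_in[OF p] by simp
next
  case False
  let ?s = "d y z"
  have s: "?s \<in> D" using d_in yz False by blast
  have "c (ext p y) t = c (ext p z) t" if "t > ?s" for t
    using that branch_cong[OF p yz, of t] d_le_iff[OF yz nonneg, of y z] by (simp add: c_ext p yz)
  then have "d (ext p y) (ext p z) \<le> ?s"
    using yz ext_in[OF p] by (simp add: d_le_iff)
  moreover have "c (ext p y) ?s \<noteq> c (ext p z) ?s"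
  proof
    assume "c (ext p y) ?s = c (ext p z) ?s"
    then have "extend_perm (k ?s) (branch p ?s y) (c y ?s) = extend_perm (k ?s) (branch p ?s y) (c z ?s)"
      using branch_cong[OF p yz, of ?s] s by (simp add: c_ext p yz)
    then have "c y ?s = c z ?s"
      using extend_perm_inverse[OF branch_partial_injection[OF p yz(1) s]] c_less yz s by metis
    then show False using d_attained yz False by blast
  qed
  ultimately show ?thesis using d_ge[of "ext p y" "ext p z" ?s] ext_in p yz by force
qed

text \<open>Since \<open>ext p\<close> is an isometry taking \<open>a\<close> to \<open>b\<close>, a
  domain point of \<open>p\<close> is within \<open>t\<close> of \<open>y\<close> exactly when its
  image is within \<open>t\<close> of \<open>ext p y\<close>.\<close>

lemma branch_relcomp:
  assumes p: "p \<in> PI" and q: "q \<in> PI" and pq: "Range p = Domain q" and y: "y \<in> Y" and t: "t \<in> D"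
  shows "branch (p O q) t y = branch p t y O branch q t (ext p y)"
    and "Range (branch p t y) = Domain (branch q t (ext p y))"
proof -
  have dist: "d b (ext p y) = d a y" if "(a, b) \<in> p" for a b
    using ext_isometry[OF p, of a y] ext_extends[OF p that] PI_mem[OF p that] y by simp
  show "Range (branch p t y) = Domain (branch q t (ext p y))"
  proof (intro equalityI subsetI)
    fix u assume "u \<in> Range (branch p t y)"
    then obtain a b where ab: "(a, b) \<in> p" "d a y \<le> t" "u = c b t" by (auto simp: branch_def)
    then obtain e where "(b, e) \<in> q" using pq by blast
    then have "(u, c e t) \<in> branch q t (ext p y)" using ab dist[OF ab(1)] branchI by simp
    then show "u \<in> Domain (branch q t (ext p y))" by blast
  next
    fix u assume "u \<in> Domain (branch q t (ext p y))"
    then obtain b e where be: "(b, e) \<in> q" "d b (ext p y) \<le> t" "u = c b t" by (auto simp: branch_def)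
    then obtain a where a: "(a, b) \<in> p" using pq by blast
    then have "(c a t, u) \<in> branch p t y" using be dist[OF a] branchI by simp
    then show "u \<in> Range (branch p t y)" by blast
  qed
  show "branch (p O q) t y = branch p t y O branch q t (ext p y)"
  proof (intro equalityI subsetI)
    fix u assume "u \<in> branch (p O q) t y"
    then obtain a b e where *: "(a, b) \<in> p" "(b, e) \<in> q" "d a y \<le> t" "u = (c a t, c e t)"
      by (auto simp: branch_def)
    then have "(c a t, c b t) \<in> branch p t y" "(c b t, c e t) \<in> branch q t (ext p y)"
      using dist[OF *(1)] branchI by simp_all
    then show "u \<in> branch p t y O branch q t (ext p y)" using * by auto
  next
    fix u assume "u \<in> branch p t y O branch q t (ext p y)"
    then obtain a b b' e where *: "(a, b) \<in> p" "d a y \<le> t" "(b', e) \<in> q" "d b' (ext p y) \<le> t"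
      "c b t = c b' t" "u = (c a t, c e t)"
      unfolding branch_def by blast
    \<comment> \<open>\<open>b\<close> and \<open>b'\<close> need only agree at coordinate
      \<open>t\<close>; pulling \<open>b'\<close> back to \<open>a'\<close>,
      \<open>branch_iff\<close> shows that \<open>a\<close> and \<open>a'\<close> agree there
      too.\<close>
    then obtain a' where a': "(a', b') \<in> p" using pq by blast
    then have "d a' y \<le> t" using * dist by auto
    moreover have "c a t = c a' t"
      using branch_iff[OF p y t *(1) a' *(2)] calculation * by simp
    ultimately show "u \<in> branch (p O q) t y"
      using a' * unfolding branch_def by blast
  qed
qed

lemma ext_relcomp:
  assumes "p \<in> PI" "q \<in> PI" "Range p = Domain q" "y \<in> Y"
  shows "ext (p O q) y = ext q (ext p y)"
proof (rule point_eqI)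
  have py: "ext p y \<in> Y" using ext_in assms by simp
  have pq: "p O q \<in> PI" using partial_isometries_relcomp assms by blast
  show "ext (p O q) y \<in> Y" "ext q (ext p y) \<in> Y" using ext_in assms pq py by auto
  fix t assume t: "t \<in> D"
  show "c (ext (p O q) y) t = c (ext q (ext p y)) t"
    using extend_perm_relcomp[OF branch_partial_injection[OF assms(1,4) t]
        branch_partial_injection[OF assms(2) py t] branch_relcomp(2)[OF assms t] c_less[OF assms(4) t]]
    by (simp add: c_ext pq py assms t branch_relcomp(1)[OF assms t])
qed

lemma ext_Id_on:
  assumes "finite A" "A \<subseteq> Y" "y \<in> Y"
  shows "ext (Id_on A) y = y"
proof (rule point_eqI)
  have A: "Id_on A \<in> PI" using partial_isometries_Id_on assms by blast
  then show "ext (Id_on A) y \<in> Y" "y \<in> Y" using ext_in assms by auto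
  fix t assume t: "t \<in> D"
  have "branch (Id_on A) t y = Id_on {c a t | a. a \<in> A \<and> d a y \<le> t}"
    by (auto simp: branch_def Id_on_iff)
  then show "c (ext (Id_on A) y) t = c y t"
    using c_less[OF assms(3) t] by (simp add: c_ext A assms t extend_perm_Id_on)
qed

lemma restrict_ext_Iso:
  assumes p: "p \<in> PI"
  shows "restrict (ext p) Y \<in> carrier (Iso Y d)"
proof -
  have p': "p\<inverse> \<in> PI" using partial_isometries_converse[OF Metric_space_axioms p] .
  \<comment> \<open>\<open>q\<inverse> O q\<close> is a partial identity, whose \<open>ext\<close>
    fixes every point; functoriality thus makes \<open>ext (p\<inverse>)\<close> a two-sided inverse
    of \<open>ext p\<close>.\<close>
  have inverse: "ext q (ext (q\<inverse>) y) = y" if "q \<in> PI" "q\<inverse> \<in> PI" "y \<in> Y" for q y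
  proof -
    have "finite (Range q)" "Range q \<subseteq> Y"
      using that by (auto simp: partial_isometries_def finite_Range)
    then show ?thesis
      using ext_relcomp[OF that(2,1) _ that(3)] converse_relcomp_partial_isometry[OF that(1)]
        ext_Id_on that by simp
  qed
  have "bij_betw (ext p) Y Y"
    using inverse[OF p p'] inverse[of "p\<inverse>"] p p' ext_in
    by (intro bij_betw_byWitness[where f' = "ext (p\<inverse>)"]) auto
  then have "bij_betw (restrict (ext p) Y) Y Y" by (simp cong: bij_betw_cong)
  then show ?thesis using ext_isometry[OF p] by (simp add: Iso_iff)
qed

end

section \<open>Rounding to a finite set\<close>

text \<open>In an ultrametric triangle the two longest sides are equal, so moving an endpoint by
  less than the distance leaves the distance unchanged.\<close>

lemma (in Ultrametric_space) dist_perturb: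
  assumes "x \<in> M" "y \<in> M" "u \<in> M" "v \<in> M" "d u x < e" "d v y < e" "e \<le> d x y"
  shows "d u v = d x y"
proof (rule antisym)
  show "d u v \<le> d x y"
    using ultrametric[of u x v] ultrametric[of x y v] commute[of v y] assms
    by (auto simp: le_max_iff_disj)
  show "d x y \<le> d u v"
    using ultrametric[of x u y] ultrametric[of u v y] commute[of u x] assms
    by (auto simp: le_max_iff_disj)
qed

text \<open>\<open>r\<close> rounds to a chosen representative of each open \<open>e\<close>-ball, a
  point of \<open>A\<close> if the ball contains one; \<open>e\<close> is small enough that it
  contains at most one.\<close>

lemma (in Ultrametric_space) finite_retraction:
  assumes bdd: "mtotally_bounded M" and A: "finite A" "A \<subseteq> M"
  obtains e r where "0 < e" "\<And>y. y \<in> M \<Longrightarrow> r y \<in> M \<and> d (r y) y < e" "finite (r ` M)"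
    "\<And>y z. y \<in> M \<Longrightarrow> z \<in> M \<Longrightarrow> d y z < e \<Longrightarrow> r y = r z" "\<And>a. a \<in> A \<Longrightarrow> r a = a"
proof -
  \<comment> \<open>\<open>insert 1\<close> keeps the minimum defined when \<open>A\<close> has
    fewer than two points.\<close>
  define e where "e = Min (insert 1 ((\<lambda>(a, b). d a b) ` {(a, b) \<in> A \<times> A. a \<noteq> b}))"
  have fin: "finite ((\<lambda>(a, b). d a b) ` {(a, b) \<in> A \<times> A. a \<noteq> b})"
    using A by (intro finite_imageI) (auto intro: finite_subset[of _ "A \<times> A"])
  have e: "0 < e" unfolding e_def using fin A(2)
    by (subst Min_gr_iff) (auto intro!: mdist_pos_less)
  have sep: "a = b" if "a \<in> A" "b \<in> A" "d a b < e" for a b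
  proof (rule ccontr)
    assume "a \<noteq> b"
    then have "e \<le> d a b" unfolding e_def using fin that by (intro Min_le) auto
    then show False using that by simp
  qed
  \<comment> \<open>As a predicate in \<open>b\<close>, \<open>P y\<close> depends only on the open
    \<open>e\<close>-ball of \<open>y\<close>, so the choice operator returns one representative for
    the whole ball.\<close>
  define P where "P y b \<longleftrightarrow> b \<in> M \<and> d b y < e \<and> ((\<exists>a\<in>A. d a y < e) \<longrightarrow> b \<in> A)" for y b
  define r where "r y = (SOME b. P y b)" for y
  have P: "P y (r y)" if "y \<in> M" for y
    unfolding r_def
  proof (rule someI_ex)
    show "\<exists>b. P y b"
      by (cases "\<exists>a\<in>A. d a y < e") (use that e A in \<open>auto simp: P_def intro: exI[of _ y]\<close>)
  qed
  have near: "d b y < e \<longleftrightarrow> d b z < e" if "b \<in> M" "y \<in> M" "z \<in> M" "d y z < e" for b y z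
    using ultrametric[of b y z] ultrametric[of b z y] that commute[of y z] by auto
  have "P y = P z" if "y \<in> M" "z \<in> M" "d y z < e" for y z
  proof -
    have "(\<exists>a\<in>A. d a y < e) \<longleftrightarrow> (\<exists>a\<in>A. d a z < e)" using near[OF _ that] A(2) by blast
    then show ?thesis using near[OF _ that] by (auto simp: P_def fun_eq_iff)
  qed
  then have r: "r y = r z" if "y \<in> M" "z \<in> M" "d y z < e" for y z
    using that by (simp add: r_def)
  obtain K where K: "finite K" "K \<subseteq> M" "M \<subseteq> (\<Union>x\<in>K. mball x e)"
    using bdd[unfolded mtotally_bounded_def, rule_format, OF e] by auto
  have "r ` M \<subseteq> r ` K"
  proof
    fix u assume "u \<in> r ` M"
    then obtain y where y: "y \<in> M" "u = r y" by blast
    then obtain x where "x \<in> K" "x \<in> M" "d x y < e" using K(3) by auto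
    then show "u \<in> r ` K" using r[of x y] y by (intro image_eqI[of _ _ x]) auto
  qed
  then have "finite (r ` M)" using K(1) finite_subset by blast
  moreover have "r a = a" if a: "a \<in> A" for a
  proof -
    have "a \<in> M" "d a a < e" using a A(2) e by auto
    moreover from this have "r a \<in> A" using P[of a] a unfolding P_def by blast
    ultimately show ?thesis using P[of a] sep[of "r a" a] a by (simp add: P_def)
  qed
  moreover have "r y \<in> M \<and> d (r y) y < e" if "y \<in> M" for y using P[OF that] by (simp add: P_def)
  ultimately show ?thesis using that[of e r] e r by blast
qed

context coordinates
begin

text \<open>\<open>F p\<close> is \<open>ext p\<close> followed by rounding. Distinct points of
  \<open>B\<close> are at least \<open>e\<close> apart and rounding does not alter such distances,
  so \<open>F p\<close> is still an isometry.\<close>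

lemma finite_functorial_extension:
  assumes A: "finite A" "A \<subseteq> Y"
  obtains B F where "finite B" "A \<subseteq> B" "B \<subseteq> Y"
    "\<And>p. p \<in> partial_isometries A d \<Longrightarrow> F p \<in> carrier (Iso B d)"
    "\<And>p a b. p \<in> partial_isometries A d \<Longrightarrow> (a, b) \<in> p \<Longrightarrow> F p a = b"
    "\<And>p q. p \<in> partial_isometries A d \<Longrightarrow> q \<in> partial_isometries A d \<Longrightarrow> Range p = Domain q \<Longrightarrow>
       F (p O q) = F q \<otimes>\<^bsub>Iso B d\<^esub> F p"
proof -
  obtain e r where e: "0 < e" and r': "\<And>y. y \<in> Y \<Longrightarrow> r y \<in> Y \<and> d (r y) y < e"
    and fin: "finite (r ` Y)"
    and r_eq: "\<And>y z. y \<in> Y \<Longrightarrow> z \<in> Y \<Longrightarrow> d y z < e \<Longrightarrow> r y = r z"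
    and rA: "\<And>a. a \<in> A \<Longrightarrow> r a = a"
    by (rule finite_retraction[OF totally_bounded A]) blast
  have r: "r y \<in> Y" "d (r y) y < e" if "y \<in> Y" for y using r'[OF that] by auto
  define B where "B = r ` Y"
  define F where "F p = restrict (\<lambda>b. r (ext p b)) B" for p
  have BY: "B \<subseteq> Y" using r by (auto simp: B_def)
  have AB: "A \<subseteq> B" unfolding B_def
  proof
    show "a \<in> r ` Y" if "a \<in> A" for a using rA[OF that] that A(2) by (intro image_eqI[of a r a]) auto
  qed
  have rB: "r b = b" if b: "b \<in> B" for b
  proof -
    obtain y where y: "y \<in> Y" "b = r y" using b by (auto simp: B_def)
    then show ?thesis using r_eq[of "r y" y] r[of y] by simp
  qed
  have mB: "Metric_space B d" by (rule subspace[OF BY])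
  have r_far: "d (r u) (r v) = d u v" if "u \<in> Y" "v \<in> Y" "e \<le> d u v" for u v
    using dist_perturb[of u v "r u" "r v" e] r that by simp
  have PI: "p \<in> PI" if "p \<in> partial_isometries A d" for p
    using that partial_isometries_mono[OF A(2)] by blast
  have Iso: "F p \<in> carrier (Iso B d)" if p: "p \<in> PI" for p
  proof (rule Iso_finiteI[OF mB])
    show "finite B" using fin by (simp add: B_def)
    show "F p ` B \<subseteq> B" using BY ext_in[OF p] by (auto simp: F_def B_def)
    show "d (F p x) (F p y) = d x y" if xy: "x \<in> B" "y \<in> B" for x y
    proof (cases "x = y")
      case True
      then show ?thesis using xy BY r(1) ext_in[OF p] by (auto simp: F_def)
    next
      case False
      then have "e \<le> d x y" using r_eq[of x y] rB xy BY by force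
      then show ?thesis
        using r_far[of "ext p x" "ext p y"] ext_isometry[OF p] ext_in[OF p] xy BY
        by (auto simp: F_def subset_iff)
    qed
  qed (simp add: F_def)
  show ?thesis
  proof (rule that[of B F])
    show "finite B" using fin by (simp add: B_def)
    show "F p \<in> carrier (Iso B d)" if "p \<in> partial_isometries A d" for p
      using Iso PI that by blast
    show "F p a = b" if "p \<in> partial_isometries A d" "(a, b) \<in> p" for p a b
    proof -
      have "a \<in> A" "b \<in> A" using that by (auto simp: partial_isometries_iff)
      then show ?thesis using ext_extends[OF PI[OF that(1)] that(2)] rA AB by (auto simp: F_def)
    qed
    fix p q assume p: "p \<in> partial_isometries A d" and q: "q \<in> partial_isometries A d"
      and pq: "Range p = Domain q"
    show "F (p O q) = F q \<otimes>\<^bsub>Iso B d\<^esub> F p"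
    proof (rule Iso_eqI)
      interpret I: group "Iso B d" by (rule group_Iso)
      show "F (p O q) \<in> carrier (Iso B d)" "F q \<otimes>\<^bsub>Iso B d\<^esub> F p \<in> carrier (Iso B d)"
        using Iso PI[OF p] PI[OF q] partial_isometries_relcomp by blast+
      fix b assume b: "b \<in> B"
      then have bY: "b \<in> Y" using BY by blast
      have pb: "ext p b \<in> Y" using ext_in[OF PI[OF p] bY] .
      have rpb: "r (ext p b) \<in> B" using pb by (simp add: B_def)
      \<comment> \<open>Rounding between the two maps costs less than \<open>e\<close>; the isometry
        \<open>ext q\<close> keeps the error below \<open>e\<close>, and the final rounding removes
        it.\<close>
      have "d (ext q (r (ext p b))) (ext q (ext p b)) < e"
        using ext_isometry[OF PI[OF q] r(1)[OF pb] pb] r(2)[OF pb] by simp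
      then have "r (ext q (r (ext p b))) = r (ext q (ext p b))"
        using r_eq ext_in[OF PI[OF q]] pb r(1) by blast
      then show "F (p O q) b = (F q \<otimes>\<^bsub>Iso B d\<^esub> F p) b"
        using ext_relcomp[OF PI[OF p] PI[OF q] pq bY] rpb b
        by (simp only: Iso_mult_apply[OF Iso[OF PI[OF q]] Iso[OF PI[OF p]]]) (simp add: F_def)
    qed
  qed (use AB BY in auto)
qed

end

section \<open>Free groups acting by isometries\<close>

lemma free_ext_Nil [simp]: "free_ext G \<phi> [] = \<one>\<^bsub>G\<^esub>"
  by (simp add: free_ext_def)

lemma free_ext_Cons [simp]:
  "free_ext G \<phi> (a # w) = letter_val G \<phi> a \<otimes>\<^bsub>G\<^esub> free_ext G \<phi> w"
  by (simp add: free_ext_def)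

lemma free_ext_cong:
  "(\<And>s. s \<in> snd ` set w \<Longrightarrow> \<phi> s = \<phi>' s) \<Longrightarrow> free_ext G \<phi> w = free_ext G \<phi>' w"
  by (induction w) (auto simp: letter_val_def)

lemma free_ext_natural:
  assumes "group G" "group H" "h \<in> hom G H" and \<phi>: "\<phi> ` snd ` set w \<subseteq> carrier G"
  shows "free_ext H (\<lambda>s. h (\<phi> s)) w = h (free_ext G \<phi> w)"
proof -
  interpret group_hom G H h using assms by (simp add: group_hom_def group_hom_axioms_def)
  show ?thesis using \<phi>
  proof (induction w)
    case (Cons a w)
    then show ?case
      using G.free_ext_closed[of \<phi> w] G.letter_val_closed[of \<phi> a] by (simp add: letter_val_def)
  qed simp
qed

lemma free_group_carrier: "w \<in> carrier (free_group S) \<longleftrightarrow> snd ` set w \<subseteq> S \<and> reduced w"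
  by (simp add: free_group_def)

lemma free_group_mono: "S \<subseteq> T \<Longrightarrow> carrier (free_group S) \<subseteq> carrier (free_group T)"
  unfolding free_group_def by auto

lemma PP_mono: "X \<subseteq> Y \<Longrightarrow> PP X d \<subseteq> PP Y d"
  using partial_isometries_mono[of X Y d] unfolding PP_def by blast

lemma PP_converse:
  assumes "Metric_space X d" "p \<in> PP X d"
  shows "p\<inverse> \<in> PP X d"
proof -
  have "\<not> p\<inverse> \<subseteq> Id" using assms(2) by (auto simp: PP_def)
  then show ?thesis
    using assms(2) partial_isometries_converse[OF assms(1)] unfolding PP_def by blast
qed

lemma PP_converse_iff: "Metric_space X d \<Longrightarrow> p\<inverse> \<in> PP X d \<longleftrightarrow> p \<in> PP X d"
  using PP_converse[of X d p] PP_converse[of X d "p\<inverse>"] unfolding converse_converse by blast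

lemma Iso_inv_agree:
  assumes f: "f \<in> carrier (Iso Y d)" and f': "f' \<in> carrier (Iso Y' d')" and "Y \<subseteq> Y'"
    and agree: "\<And>y. y \<in> Y \<Longrightarrow> f' y = f y" and y: "y \<in> Y"
  shows "(inv\<^bsub>Iso Y' d'\<^esub> f') y = (inv\<^bsub>Iso Y d\<^esub> f) y"
proof -
  interpret I: group "Iso Y d" by (rule group_Iso)
  interpret I': group "Iso Y' d'" by (rule group_Iso)
  let ?z = "(inv\<^bsub>Iso Y d\<^esub> f) y"
  have z: "?z \<in> Y" using Iso_closed[OF I.inv_closed[OF f] y] .
  have "f ?z = y"
    using Iso_mult_apply[OF f I.inv_closed[OF f] y] I.r_inv[OF f] y by (simp add: Iso_one)
  then have "(inv\<^bsub>Iso Y' d'\<^esub> f') y = (inv\<^bsub>Iso Y' d'\<^esub> f') (f' ?z)" using agree[OF z] by simp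
  also have "\<dots> = ?z"
    using Iso_mult_apply[OF I'.inv_closed[OF f'] f', of ?z] I'.l_inv[OF f'] z \<open>Y \<subseteq> Y'\<close>
    by (auto simp: Iso_one)
  finally show ?thesis .
qed

lemma free_ext_agree:
  assumes YY: "Y \<subseteq> Y'"
    and \<phi>: "\<And>s. s \<in> S \<Longrightarrow> \<phi> s \<in> carrier (Iso Y d)" and \<phi>': "\<And>s. s \<in> S \<Longrightarrow> \<phi>' s \<in> carrier (Iso Y' d')"
    and agree: "\<And>s y. s \<in> S \<Longrightarrow> y \<in> Y \<Longrightarrow> \<phi>' s y = \<phi> s y"
    and w: "snd ` set w \<subseteq> S" and y: "y \<in> Y"
  shows "free_ext (Iso Y' d') \<phi>' w y = free_ext (Iso Y d) \<phi> w y"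
  using w y
proof (induction w arbitrary: y)
  case Nil
  then show ?case using YY by (auto simp: Iso_one)
next
  case (Cons a w)
  interpret I: group "Iso Y d" by (rule group_Iso)
  interpret I': group "Iso Y' d'" by (rule group_Iso)
  let ?f = "free_ext (Iso Y d) \<phi> w" and ?f' = "free_ext (Iso Y' d') \<phi>' w"
  have s: "snd a \<in> S" using Cons.prems by simp
  have sub: "\<phi> ` snd ` set w \<subseteq> carrier (Iso Y d)" "\<phi>' ` snd ` set w \<subseteq> carrier (Iso Y' d')"
    using Cons.prems(1) \<phi> \<phi>' by force+
  note f = I.free_ext_closed[OF sub(1)] I'.free_ext_closed[OF sub(2)]
  note l = I.letter_val_closed[of \<phi> a, OF \<phi>[OF s]] I'.letter_val_closed[of \<phi>' a, OF \<phi>'[OF s]]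
  have letter: "letter_val (Iso Y' d') \<phi>' a z = letter_val (Iso Y d) \<phi> a z" if "z \<in> Y" for z
    using Iso_inv_agree[OF \<phi>[OF s] \<phi>'[OF s] YY agree[OF s] that] agree[OF s that]
    by (simp add: letter_val_def)
  have "y \<in> Y'" using Cons.prems(2) YY by blast
  then have "free_ext (Iso Y' d') \<phi>' (a # w) y = letter_val (Iso Y' d') \<phi>' a (?f' y)"
    using Iso_mult_apply[OF l(2) f(2)] by simp
  also have "?f' y = ?f y" using Cons.IH Cons.prems by simp
  also have "letter_val (Iso Y' d') \<phi>' a (?f y) = letter_val (Iso Y d) \<phi> a (?f y)"
    using letter Iso_closed[OF f(1) Cons.prems(2)] .
  also have "\<dots> = free_ext (Iso Y d) \<phi> (a # w) y"
    using Iso_mult_apply[OF l(1) f(1) Cons.prems(2)] by simp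
  finally show ?case .
qed

section \<open>Minimal S-extensions and a criterion for coherence\<close>

lemma S_extension_Iso: "S_extension e X d Y d' \<phi> \<Longrightarrow> p \<in> PP X d \<Longrightarrow> \<phi> p \<in> carrier (Iso Y d')"
  unfolding S_extension_def by blast

lemma S_extension_extends:
  assumes "S_extension e X d Y d' \<phi>" "p \<in> PP X d" "(x, y) \<in> p"
  shows "\<phi> p (e x) = e y"
proof -
  have "case (x, y) of (x, y) \<Rightarrow> \<phi> p (e x) = e y"
    using assms unfolding S_extension_def by blast
  then show ?thesis by simp
qed

lemma PP_mem: "p \<in> PP X d \<Longrightarrow> (x, y) \<in> p \<Longrightarrow> x \<in> X \<and> y \<in> X"
  by (rule partial_isometry_mem[of p X d]) (simp_all add: PP_def)

text \<open>Inverse compatibility turns an inverse letter into the generator at the converse, so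
  every letter acts as some \<open>\<phi> p\<close>.\<close>

lemma letter_val_generator:
  assumes "minimal_S_extension X Y d \<phi>" "snd a \<in> PP X d"
  shows "letter_val (Iso Y d) \<phi> a = \<phi> (if fst a then snd a else (snd a)\<inverse>)"
  using assms by (simp add: letter_val_def minimal_S_extension_def inverse_compatible_def)

text \<open>Once the map is well defined on words (\<open>wd\<close>), injectivity follows because
  each image isometry restricts to the original one on \<open>Y1\<close>, and uniqueness because the
  \<open>\<phi>1 p\<close> generate.\<close>

lemma coherentI:
  assumes m1: "minimal_S_extension X1 Y1 d \<phi>1" and m2: "minimal_S_extension X2 Y2 d \<phi>2"
    and XX: "X1 \<subseteq> X2" and YY: "Y1 \<subseteq> Y2"
    and agree: "\<And>p y. p \<in> PP X1 d \<Longrightarrow> y \<in> Y1 \<Longrightarrow> \<phi>2 p y = \<phi>1 p y"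
    and wd: "\<And>v w. v \<in> carrier (free_group (PP X1 d)) \<Longrightarrow> w \<in> carrier (free_group (PP X1 d)) \<Longrightarrow>
      free_ext (Iso Y1 d) \<phi>1 v = free_ext (Iso Y1 d) \<phi>1 w \<Longrightarrow>
      free_ext (Iso Y2 d) \<phi>2 v = free_ext (Iso Y2 d) \<phi>2 w"
  shows "coherent X1 Y1 \<phi>1 X2 Y2 \<phi>2 d"
proof -
  let ?F1 = "free_ext (Iso Y1 d) \<phi>1" and ?F2 = "free_ext (Iso Y2 d) \<phi>2"
  let ?W1 = "carrier (free_group (PP X1 d))" and ?W2 = "carrier (free_group (PP X2 d))"
  let ?G1 = "free_image X1 Y1 d \<phi>1" and ?G2 = "free_image X2 Y2 d \<phi>2"
  interpret I1: group "Iso Y1 d" by (rule group_Iso)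
  interpret I2: group "Iso Y2 d" by (rule group_Iso)
  interpret W1: group "free_group (PP X1 d)" by (rule group_free_group)
  have s1: "S_extension (\<lambda>x. x) X1 d Y1 d \<phi>1" and s2: "S_extension (\<lambda>x. x) X2 d Y2 d \<phi>2"
    using m1 m2 by (auto simp: minimal_S_extension_def)
  have X1: "Metric_space X1 d" using s1 by (auto simp: S_extension_def metric_extension_def)
  have PP: "PP X1 d \<subseteq> PP X2 d" using PP_mono[OF XX] .
  have \<phi>1: "\<phi>1 \<in> PP X1 d \<rightarrow> carrier (Iso Y1 d)" and \<phi>2: "\<phi>2 \<in> PP X2 d \<rightarrow> carrier (Iso Y2 d)"
    using s1 s2 by (auto simp: S_extension_def)
  have \<phi>2': "\<phi>2 \<in> PP X1 d \<rightarrow> carrier (Iso Y2 d)" using \<phi>2 PP by auto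
  have WW: "?W1 \<subseteq> ?W2" by (rule free_group_mono[OF PP])
  have h1: "?F1 \<in> hom (free_group (PP X1 d)) (Iso Y1 d)" using I1.free_ext_hom[OF \<phi>1] .
  have h2: "?F2 \<in> hom (free_group (PP X1 d)) (Iso Y2 d)" using I2.free_ext_hom[OF \<phi>2'] .
  have carrier: "carrier ?G1 = ?F1 ` ?W1" "carrier ?G2 = ?F2 ` ?W2"
    and mult: "(\<otimes>\<^bsub>?G1\<^esub>) = (\<otimes>\<^bsub>Iso Y1 d\<^esub>)" "(\<otimes>\<^bsub>?G2\<^esub>) = (\<otimes>\<^bsub>Iso Y2 d\<^esub>)"
    by (simp_all add: free_image_def)
  have single: "[(True, p)] \<in> ?W1" if "p \<in> PP X1 d" for p
    using that by (simp add: free_group_carrier reduced_def)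
  have gen: "?F1 [(True, p)] = \<phi>1 p" "?F2 [(True, p)] = \<phi>2 p" if "p \<in> PP X1 d" for p
    using I1.free_ext_generator[of \<phi>1 p] I2.free_ext_generator[of \<phi>2 p] that \<phi>1 \<phi>2'
    by (simp_all add: Pi_iff del: free_ext_Cons)
  define h where "h = (\<lambda>g\<in>?F1 ` ?W1. ?F2 (inv_into ?W1 ?F1 g))"
  have h: "h (?F1 w) = ?F2 w" if "w \<in> ?W1" for w
    using wd[of "inv_into ?W1 ?F1 (?F1 w)" w] that
    by (simp add: h_def inv_into_into f_inv_into_f)
  have mon: "h \<in> mon ?G1 ?G2"
    unfolding mon_def
  proof (intro CollectI conjI homI)
    fix x assume "x \<in> carrier ?G1"
    then obtain v where v: "v \<in> ?W1" "x = ?F1 v" by (auto simp: carrier)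
    then show "h x \<in> carrier ?G2" using h WW by (auto simp: carrier)
    fix y assume "y \<in> carrier ?G1"
    then obtain w where w: "w \<in> ?W1" "y = ?F1 w" by (auto simp: carrier)
    show "h (x \<otimes>\<^bsub>?G1\<^esub> y) = h x \<otimes>\<^bsub>?G2\<^esub> h y"
      using h[of "v \<otimes>\<^bsub>free_group (PP X1 d)\<^esub> w"] v w h
      by (simp add: mult hom_mult[OF h1] hom_mult[OF h2])
  next
    show "inj_on h (carrier ?G1)"
    proof (rule inj_onI)
      fix x y assume "x \<in> carrier ?G1" "y \<in> carrier ?G1" and eq: "h x = h y"
      then obtain v w where vw: "v \<in> ?W1" "x = ?F1 v" "w \<in> ?W1" "y = ?F1 w" by (auto simp: carrier)
      have "?F2 u z = ?F1 u z" if "u \<in> ?W1" "z \<in> Y1" for u z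
        by (rule free_ext_agree[OF YY, of "PP X1 d"])
          (use that \<phi>1 \<phi>2' agree in \<open>auto simp: free_group_carrier\<close>)
      then have "x z = y z" if "z \<in> Y1" for z
        using vw eq h that by metis
      moreover have "x \<in> carrier (Iso Y1 d)" "y \<in> carrier (Iso Y1 d)"
        using vw hom_in_carrier[OF h1] by auto
      ultimately show "x = y" using Iso_eqI by blast
    qed
  qed
  have unique: "h' (?F1 w) = ?F2 w"
    if h': "h' \<in> mon ?G1 ?G2" "\<forall>p\<in>PP X1 d. h' (\<phi>1 p) = \<phi>2 p" and w: "w \<in> ?W1" for h' w
    using w
  proof (induction w)
    have hom': "h' \<in> hom ?G1 ?G2" using h' by (simp add: mon_def)
    have mult': "h' (x \<otimes>\<^bsub>Iso Y1 d\<^esub> y) = h' x \<otimes>\<^bsub>Iso Y2 d\<^esub> h' y"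
      if "x \<in> ?F1 ` ?W1" "y \<in> ?F1 ` ?W1" for x y
      using hom_mult[OF hom'] that by (simp add: carrier mult)
    {
      case Nil
      \<comment> \<open>\<open>h'\<close> sends the unit to an idempotent of the group
        \<open>Iso Y2 d\<close>, hence to its unit.\<close>
      have one: "\<one>\<^bsub>Iso Y1 d\<^esub> \<in> ?F1 ` ?W1" using Nil by (intro image_eqI[of _ _ "[]"]) simp_all
      then have "h' \<one>\<^bsub>Iso Y1 d\<^esub> \<in> ?F2 ` ?W2" using hom_in_carrier[OF hom'] by (simp add: carrier)
      then have "h' \<one>\<^bsub>Iso Y1 d\<^esub> \<in> carrier (Iso Y2 d)"
        using hom_in_carrier[OF I2.free_ext_hom[OF \<phi>2]] by auto
      then show ?case using mult'[OF one one] by simp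
    next
      case (Cons a w)
      have w: "w \<in> ?W1" and a: "snd a \<in> PP X1 d"
        using Cons.prems by (auto simp: free_group_carrier reduced_Cons)
      \<comment> \<open>The hypothesis on \<open>h'\<close> speaks of generators only, so a negative
        letter is replaced by the generator at the converse.\<close>
      let ?q = "if fst a then snd a else (snd a)\<inverse>"
      have q: "?q \<in> PP X1 d" using a PP_converse[OF X1] by auto
      have "\<phi>1 ?q \<in> ?F1 ` ?W1" using single[OF q] gen(1)[OF q] by (metis image_eqI)
      then have "h' (\<phi>1 ?q \<otimes>\<^bsub>Iso Y1 d\<^esub> ?F1 w) = \<phi>2 ?q \<otimes>\<^bsub>Iso Y2 d\<^esub> ?F2 w"
        using mult'[of "\<phi>1 ?q" "?F1 w"] w h'(2) q Cons.IH by auto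
      then show ?case
        using letter_val_generator[OF m1 a] letter_val_generator[OF m2, of a] a PP by auto
    }
  qed
  show ?thesis
    unfolding coherent_def
  proof (intro conjI ballI ex1I[of _ h])
    show "h \<in> extensional (carrier ?G1)" by (simp add: h_def carrier)
    show "h (\<phi>1 p) = \<phi>2 p" if "p \<in> PP X1 d" for p
      using h[OF single[OF that]] gen[OF that] by simp
    fix h' assume h': "h' \<in> extensional (carrier ?G1) \<and> h' \<in> mon ?G1 ?G2 \<and>
      (\<forall>p\<in>PP X1 d. h' (\<phi>1 p) = \<phi>2 p)"
    show "h' = h"
    proof (rule extensionalityI[of _ "carrier ?G1"])
      show "h' \<in> extensional (carrier ?G1)" "h \<in> extensional (carrier ?G1)"
        using h' by (simp_all add: h_def carrier)
      fix g assume "g \<in> carrier ?G1"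
      then show "h' g = h g" using unique h' h by (auto simp: carrier)
    qed
  qed (use YY agree mon in auto)
qed

text \<open>Cutting down to the orbit of \<open>X\<close> enforces minimality. The orbit is stable
  under each \<open>\<theta> p\<close>, since a generator times a word is again an element of the
  free group, and words act on it as they do in \<open>B\<close>.\<close>

lemma minimal_restriction:
  assumes s: "S_extension (\<lambda>x. x) X d B d \<theta>" and inv: "inverse_compatible X B d \<theta>"
    and fin: "finite B"
  defines "Y \<equiv> {free_ext (Iso B d) \<theta> w x | w x. w \<in> carrier (free_group (PP X d)) \<and> x \<in> X}"
  shows "Y \<subseteq> B" "minimal_S_extension X Y d (\<lambda>p. restrict (\<theta> p) Y)"
proof -
  let ?W = "carrier (free_group (PP X d))" and ?F = "free_ext (Iso B d) \<theta>"
  interpret I: group "Iso B d" by (rule group_Iso)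
  interpret W: group "free_group (PP X d)" by (rule group_free_group)
  have XB: "X \<subseteq> B" and mX: "Metric_space X d" and mB: "Metric_space B d"
    using s unfolding S_extension_def metric_extension_def by auto
  have \<theta>: "\<theta> \<in> PP X d \<rightarrow> carrier (Iso B d)" using s unfolding S_extension_def by blast
  have hom: "?F \<in> hom (free_group (PP X d)) (Iso B d)" using I.free_ext_hom[OF \<theta>] .
  show YB: "Y \<subseteq> B"
  proof
    fix y assume "y \<in> Y"
    then obtain w x where w: "w \<in> ?W" "x \<in> X" "y = ?F w x" unfolding Y_def by blast
    then show "y \<in> B" using Iso_closed[OF hom_in_carrier[OF hom w(1)], of x] XB by auto
  qed
  have XY: "X \<subseteq> Y"
  proof
    fix x assume "x \<in> X"
    then have "x = ?F [] x" "[] \<in> ?W" using XB by (auto simp: Iso_one free_group_carrier)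
    then show "x \<in> Y" unfolding Y_def using \<open>x \<in> X\<close> by blast
  qed
  have inY: "\<theta> p y \<in> Y" if p: "p \<in> PP X d" and y: "y \<in> Y" for p y
  proof -
    obtain w x where w: "w \<in> ?W" "x \<in> X" "y = ?F w x" using y unfolding Y_def by blast
    have p': "[(True, p)] \<in> ?W" using p by (simp add: free_group_carrier reduced_def)
    have \<theta>p: "\<theta> p \<in> carrier (Iso B d)" using \<theta> p by auto
    have "?F ([(True, p)] \<otimes>\<^bsub>free_group (PP X d)\<^esub> w) = \<theta> p \<otimes>\<^bsub>Iso B d\<^esub> ?F w"
      using hom_mult[OF hom p' w(1)] I.free_ext_generator[of \<theta> p, OF \<theta>p] by simp
    then have "\<theta> p y = ?F ([(True, p)] \<otimes>\<^bsub>free_group (PP X d)\<^esub> w) x"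
      using Iso_mult_apply[OF \<theta>p hom_in_carrier[OF hom w(1)]] w XB by auto
    then show ?thesis unfolding Y_def using W.m_closed[OF p' w(1)] w(2) by blast
  qed
  have mY: "Metric_space Y d" using Metric_space.subspace[OF mB YB] .
  have Iso: "restrict (\<theta> p) Y \<in> carrier (Iso Y d)" if p: "p \<in> PP X d" for p
  proof (rule Iso_finiteI[OF mY])
    show "finite Y" using fin YB finite_subset by blast
    show "restrict (\<theta> p) Y ` Y \<subseteq> Y" using inY p by auto
    show "d (restrict (\<theta> p) Y x) (restrict (\<theta> p) Y y) = d x y" if "x \<in> Y" "y \<in> Y" for x y
      using \<theta> p that YB by (auto simp: Iso_iff Pi_iff)
  qed simp
  have F: "free_ext (Iso Y d) (\<lambda>p. restrict (\<theta> p) Y) w y = ?F w y" if "w \<in> ?W" "y \<in> Y" for w y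
    by (rule free_ext_agree[OF YB, of "PP X d", symmetric])
      (use that Iso \<theta> in \<open>auto simp: free_group_carrier\<close>)
  show "minimal_S_extension X Y d (\<lambda>p. restrict (\<theta> p) Y)"
    unfolding minimal_S_extension_def
  proof (intro conjI ballI)
    show "S_extension (\<lambda>x. x) X d Y d (\<lambda>p. restrict (\<theta> p) Y)"
      unfolding S_extension_def metric_extension_def
    proof (intro conjI ballI)
      fix p z assume p: "p \<in> PP X d" "z \<in> p"
      obtain x y where z: "z = (x, y)" by (cases z)
      then show "case z of (x, y) \<Rightarrow> restrict (\<theta> p) Y x = y"
        using S_extension_extends[OF s p(1), of x y] PP_mem[OF p(1), of x y] p(2) XY by auto
    qed (use mX mY XY Iso in auto)
    show "inverse_compatible X Y d (\<lambda>p. restrict (\<theta> p) Y)"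
      unfolding inverse_compatible_def
    proof
      fix p assume p: "p \<in> PP X d"
      interpret IY: group "Iso Y d" by (rule group_Iso)
      show "restrict (\<theta> (p\<inverse>)) Y = inv\<^bsub>Iso Y d\<^esub> (restrict (\<theta> p) Y)"
      proof (rule Iso_eqI)
        show "restrict (\<theta> (p\<inverse>)) Y \<in> carrier (Iso Y d)" using Iso PP_converse[OF mX p] by blast
        show "inv\<^bsub>Iso Y d\<^esub> (restrict (\<theta> p) Y) \<in> carrier (Iso Y d)" using Iso[OF p] by simp
        fix y assume y: "y \<in> Y"
        have "(inv\<^bsub>Iso B d\<^esub> \<theta> p) y = (inv\<^bsub>Iso Y d\<^esub> (restrict (\<theta> p) Y)) y"
          by (rule Iso_inv_agree[OF Iso[OF p] _ YB _ y]) (use \<theta> p in auto)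
        then show "restrict (\<theta> (p\<inverse>)) Y y = (inv\<^bsub>Iso Y d\<^esub> (restrict (\<theta> p) Y)) y"
          using inv p y by (simp add: inverse_compatible_def)
      qed
    qed
    fix y assume "y \<in> Y"
    then obtain w x where w: "w \<in> ?W" "x \<in> X" "y = ?F w x" unfolding Y_def by blast
    then have "y = free_ext (Iso Y d) (\<lambda>p. restrict (\<theta> p) Y) w x" using F XY by auto
    then show "\<exists>g\<in>?W. \<exists>x\<in>X. y = free_ext (Iso Y d) (\<lambda>p. restrict (\<theta> p) Y) g x"
      using w by blast
  qed
qed

section \<open>Coherent extensions\<close>

definition graph_on :: "'a set \<Rightarrow> ('a \<Rightarrow> 'b) \<Rightarrow> ('a \<times> 'b) set" where
  "graph_on S f = (\<lambda>x. (x, f x)) ` S"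

lemma graph_on_Iso:
  assumes "finite Y" "g \<in> carrier (Iso Y d)"
  shows "graph_on Y g \<in> partial_isometries Y d" "Domain (graph_on Y g) = Y" "Range (graph_on Y g) = Y"
  using assms
  by (auto simp: graph_on_def partial_isometries_iff single_valued_def Iso_iff bij_betw_def
      Range_snd image_image)

lemma graph_on_mult:
  assumes "f \<in> carrier (Iso Y d)" "g \<in> carrier (Iso Y d)"
  shows "graph_on Y (f \<otimes>\<^bsub>Iso Y d\<^esub> g) = graph_on Y g O graph_on Y f"
  using assms Iso_closed[OF assms(2)] by (auto simp: graph_on_def Iso_mult_apply image_iff relcomp_unfold)

lemma (in coordinates) coherent_extension:
  assumes XX: "X1 \<subseteq> X2" and X2: "X2 \<subseteq> Y" "finite X2" and Y1: "finite Y1" "Y1 \<subseteq> Y"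
    and m1: "minimal_S_extension X1 Y1 d \<phi>1"
  obtains Y2 \<phi>2 where "finite Y2" "Y2 \<subseteq> Y" "minimal_S_extension X2 Y2 d \<phi>2"
    "coherent X1 Y1 \<phi>1 X2 Y2 \<phi>2 d"
proof -
  let ?A = "Y1 \<union> X2"
  obtain B F where fin: "finite B" and AB: "?A \<subseteq> B" and BY: "B \<subseteq> Y"
    and Iso: "\<And>p. p \<in> partial_isometries ?A d \<Longrightarrow> F p \<in> carrier (Iso B d)"
    and ext: "\<And>p a b. p \<in> partial_isometries ?A d \<Longrightarrow> (a, b) \<in> p \<Longrightarrow> F p a = b"
    and comp: "\<And>p q. p \<in> partial_isometries ?A d \<Longrightarrow> q \<in> partial_isometries ?A d \<Longrightarrow>
      Range p = Domain q \<Longrightarrow> F (p O q) = F q \<otimes>\<^bsub>Iso B d\<^esub> F p"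
    by (rule finite_functorial_extension[of ?A]) (use X2 Y1 in auto)
  interpret I1: group "Iso Y1 d" by (rule group_Iso)
  interpret IB: group "Iso B d" by (rule group_Iso)
  have s1: "S_extension (\<lambda>x. x) X1 d Y1 d \<phi>1" and inv1: "inverse_compatible X1 Y1 d \<phi>1"
    using m1 by (auto simp: minimal_S_extension_def)
  have \<phi>1: "\<phi>1 p \<in> carrier (Iso Y1 d)" if "p \<in> PP X1 d" for p using S_extension_Iso[OF s1 that] .
  have XY1: "X1 \<subseteq> Y1" using s1 by (auto simp: S_extension_def metric_extension_def)
  have mX1: "Metric_space X1 d" and mX2: "Metric_space X2 d" and mB: "Metric_space B d"
    and mA: "Metric_space ?A d"
    using XX X2 BY AB by (auto intro!: subspace)
  have graph: "graph_on Y1 g \<in> partial_isometries ?A d" if "g \<in> carrier (Iso Y1 d)" for g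
    using graph_on_Iso(1)[OF Y1(1) that] partial_isometries_mono[of Y1 ?A d] by blast
  \<comment> \<open>Graphs turn products into relational composites in reverse order and
    \<open>comp\<close> reverses again, so \<open>\<psi>\<close> is a homomorphism; all graphs are
    composable, having domain and range \<open>Y1\<close>.\<close>
  define \<psi> where "\<psi> g = F (graph_on Y1 g)" for g
  have \<psi>_hom: "\<psi> \<in> hom (Iso Y1 d) (Iso B d)"
    using Iso graph graph_on_Iso[OF Y1(1)]
    by (intro homI) (auto simp: \<psi>_def graph_on_mult comp)
  have \<psi>_ext: "\<psi> g y = g y" if "g \<in> carrier (Iso Y1 d)" "y \<in> Y1" for g y
    using ext[OF graph[OF that(1)]] that(2) by (auto simp: \<psi>_def graph_on_def)
  interpret \<psi>: group_hom "Iso Y1 d" "Iso B d" \<psi>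
    using \<psi>_hom by unfold_locales
  have PP2: "p \<in> partial_isometries ?A d" if "p \<in> PP X2 d" for p
    using that partial_isometries_mono[of X2 ?A d] by (auto simp: PP_def)
  have F_inv: "F (p\<inverse>) = inv\<^bsub>Iso B d\<^esub> F p" if p: "p \<in> partial_isometries ?A d" for p
  proof -
    have p': "p\<inverse> \<in> partial_isometries ?A d" using partial_isometries_converse[OF mA p] .
    \<comment> \<open>The partial identity \<open>p\<inverse> O p\<close> is idempotent, so its
      image is an idempotent of a group, which is the unit.\<close>
    let ?I = "Id_on (Range p)"
    have Id: "p\<inverse> O p = ?I" using converse_relcomp_partial_isometry[OF p] .
    have I: "?I \<in> partial_isometries ?A d"
      using partial_isometries_relcomp[OF p' p] Id by simp
    have "?I O ?I = ?I" by (auto simp: Id_on_iff)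
    then have "F ?I \<otimes>\<^bsub>Iso B d\<^esub> F ?I = F ?I" using comp[OF I I] by simp
    then have "F ?I = \<one>\<^bsub>Iso B d\<^esub>" using Iso[OF I] by simp
    then have "F p \<otimes>\<^bsub>Iso B d\<^esub> F (p\<inverse>) = \<one>\<^bsub>Iso B d\<^esub>" using comp[OF p' p] Id by simp
    then show ?thesis using IB.inv_equality[of "F (p\<inverse>)" "F p"] IB.inv_comm Iso p p' by metis
  qed
  \<comment> \<open>On \<open>PP X1 d\<close> the action must continue the given
    \<open>\<phi>1\<close>, so \<open>\<phi>1 p\<close> is extended in place of \<open>p\<close>;
    the remaining generators are extended directly.\<close>
  define \<theta> where "\<theta> p = (if p \<in> PP X1 d then \<psi> (\<phi>1 p) else F p)" for p
  have \<theta>: "\<theta> \<in> PP X2 d \<rightarrow> carrier (Iso B d)"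
  proof (rule Pi_I)
    fix p assume p: "p \<in> PP X2 d"
    show "\<theta> p \<in> carrier (Iso B d)"
      using Iso[OF PP2[OF p]] hom_in_carrier[OF \<psi>_hom \<phi>1] by (simp add: \<theta>_def)
  qed
  have sB: "S_extension (\<lambda>x. x) X2 d B d \<theta>"
    unfolding S_extension_def metric_extension_def
  proof (intro conjI ballI)
    fix p z assume p: "p \<in> PP X2 d" "z \<in> p"
    obtain x y where z: "z = (x, y)" by (cases z)
    have "\<theta> p x = y"
    proof (cases "p \<in> PP X1 d")
      case True
      have "\<psi> (\<phi>1 p) x = \<phi>1 p x"
        using \<psi>_ext[OF \<phi>1[OF True], of x] PP_mem[OF True, of x y] p(2) z XY1 by blast
      then show ?thesis
        using S_extension_extends[OF s1 True, of x y] True p(2) z by (simp add: \<theta>_def)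
    next
      case False
      then show ?thesis using ext[OF PP2[OF p(1)], of x y] p(2) z by (simp add: \<theta>_def)
    qed
    then show "case z of (x, y) \<Rightarrow> \<theta> p x = y" by (simp add: z)
  qed (use mX2 mB AB \<theta> in auto)
  have invB: "inverse_compatible X2 B d \<theta>"
    unfolding inverse_compatible_def
  proof
    fix p assume p: "p \<in> PP X2 d"
    show "\<theta> (p\<inverse>) = inv\<^bsub>Iso B d\<^esub> \<theta> p"
      using inv1 \<phi>1 F_inv[OF PP2[OF p]]
      by (auto simp: \<theta>_def PP_converse_iff[OF mX1] inverse_compatible_def)
  qed
  define Y2 where "Y2 = {free_ext (Iso B d) \<theta> w x | w x. w \<in> carrier (free_group (PP X2 d)) \<and> x \<in> X2}"
  define \<phi>2 where "\<phi>2 p = restrict (\<theta> p) Y2" for p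
  have Y2B: "Y2 \<subseteq> B" and m2: "minimal_S_extension X2 Y2 d \<phi>2"
    using minimal_restriction[OF sB invB fin] unfolding Y2_def \<phi>2_def by auto
  have s2: "S_extension (\<lambda>x. x) X2 d Y2 d \<phi>2" using m2 by (auto simp: minimal_S_extension_def)
  have PP: "PP X1 d \<subseteq> PP X2 d" using PP_mono[OF XX] .
  \<comment> \<open>Words over \<open>PP X1 d\<close> act on \<open>B\<close> through
    \<open>\<psi>\<close>, so words with equal value in \<open>Iso Y1 d\<close> have equal value in
    \<open>Iso B d\<close>.\<close>
  have push: "free_ext (Iso B d) \<theta> w = \<psi> (free_ext (Iso Y1 d) \<phi>1 w)"
    if "w \<in> carrier (free_group (PP X1 d))" for w
  proof -
    have w: "snd ` set w \<subseteq> PP X1 d" using that by (simp add: free_group_carrier)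
    have "free_ext (Iso B d) \<theta> w = free_ext (Iso B d) (\<lambda>p. \<psi> (\<phi>1 p)) w"
      using w by (intro free_ext_cong) (auto simp: \<theta>_def)
    then show ?thesis
      using free_ext_natural[OF group_Iso group_Iso \<psi>_hom, of \<phi>1 w] w \<phi>1 by auto
  qed
  have closed1: "free_ext (Iso Y1 d) \<phi>1 w \<in> carrier (Iso Y1 d)"
    if "w \<in> carrier (free_group (PP X1 d))" for w
    using that \<phi>1 by (intro I1.free_ext_closed) (auto simp: free_group_carrier)
  \<comment> \<open>Minimality of the given extension enters here: each point of \<open>Y1\<close>
    is reached from \<open>X1\<close> by a word, and the same word reaches it in
    \<open>B\<close>.\<close>
  have YY: "Y1 \<subseteq> Y2"
  proof
    fix y assume y: "y \<in> Y1"
    then obtain w x where w: "w \<in> carrier (free_group (PP X1 d))" "x \<in> X1"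
      "y = free_ext (Iso Y1 d) \<phi>1 w x"
      using m1 unfolding minimal_S_extension_def by blast
    then have "y = free_ext (Iso B d) \<theta> w x"
      using push[OF w(1)] \<psi>_ext[OF closed1[OF w(1)]] XY1 by auto
    moreover have "w \<in> carrier (free_group (PP X2 d))" using w(1) free_group_mono[OF PP] by blast
    ultimately show "y \<in> Y2" unfolding Y2_def using w(2) XX by blast
  qed
  have "coherent X1 Y1 \<phi>1 X2 Y2 \<phi>2 d"
  proof (rule coherentI[OF m1 m2 XX YY])
    show "\<phi>2 p y = \<phi>1 p y" if "p \<in> PP X1 d" "y \<in> Y1" for p y
      using that YY \<psi>_ext[OF \<phi>1] by (auto simp: \<phi>2_def \<theta>_def)
    fix v w assume v: "v \<in> carrier (free_group (PP X1 d))" and w: "w \<in> carrier (free_group (PP X1 d))"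
      and eq: "free_ext (Iso Y1 d) \<phi>1 v = free_ext (Iso Y1 d) \<phi>1 w"
    have F2: "free_ext (Iso Y2 d) \<phi>2 u y = free_ext (Iso B d) \<theta> u y"
      if "u \<in> carrier (free_group (PP X1 d))" "y \<in> Y2" for u y
      by (rule free_ext_agree[OF Y2B, of "PP X2 d", symmetric])
        (use that PP S_extension_Iso[OF s2] \<theta> in \<open>auto simp: free_group_carrier \<phi>2_def\<close>)
    have c2: "free_ext (Iso Y2 d) \<phi>2 u \<in> carrier (Iso Y2 d)"
      if "u \<in> carrier (free_group (PP X1 d))" for u
      using that PP S_extension_Iso[OF s2]
      by (intro group.free_ext_closed[OF group_Iso]) (auto simp: free_group_carrier)
    show "free_ext (Iso Y2 d) \<phi>2 v = free_ext (Iso Y2 d) \<phi>2 w"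
      by (rule Iso_eqI[OF c2[OF v] c2[OF w]]) (simp add: F2 v w push eq)
  qed
  moreover have "finite Y2" "Y2 \<subseteq> Y" using Y2B fin BY finite_subset by auto
  ultimately show ?thesis using that m2 by blast
qed

lemma (in coordinates) ultraextensive: "ultraextensive Y d"
  unfolding ultraextensive_def
proof (intro conjI allI impI ballI)
  show "Metric_space Y d" by (rule Metric_space_axioms)
  show "\<exists>f\<in>carrier (Iso Y d). \<forall>(x, y)\<in>p. f x = y" if p: "p \<in> PI" for p
    using restrict_ext_Iso[OF p] ext_extends[OF p] PI_mem[OF p]
    by (intro bexI[of _ "restrict (ext p) Y"]) auto
  show "\<exists>Y' \<phi>. finite Y' \<and> Y' \<subseteq> Y \<and> S_extension (\<lambda>x. x) X d Y' d \<phi>" if X: "finite X \<and> X \<subseteq> Y" for X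
  proof -
    \<comment> \<open>With no points there are no generators, so the empty extension of the empty
      set is minimal; extending it coherently to \<open>X\<close> yields a finite S-extension of
      \<open>X\<close>.\<close>
    have "PP {} d = {}" by (auto simp: PP_def partial_isometries_def)
    then have m: "minimal_S_extension {} {} d (\<lambda>p. undefined)"
      using subspace[of "{}"]
      by (simp add: minimal_S_extension_def S_extension_def metric_extension_def inverse_compatible_def)
    obtain Y2 \<phi>2 where "finite Y2" "Y2 \<subseteq> Y" "minimal_S_extension X Y2 d \<phi>2"
      "coherent {} {} (\<lambda>p. undefined) X Y2 \<phi>2 d"
      by (rule coherent_extension[of "{}" X "{}" "\<lambda>p. undefined"]) (use X m in simp_all)
    then show ?thesis unfolding minimal_S_extension_def by blast
  qed
  fix X1 X2 Y1 \<phi>1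
  assume *: "X1 \<subseteq> X2 \<and> X2 \<subseteq> Y \<and> finite X2 \<and> finite Y1 \<and> Y1 \<subseteq> Y \<and> minimal_S_extension X1 Y1 d \<phi>1"
  obtain Y2 \<phi>2 where "finite Y2" "Y2 \<subseteq> Y" "minimal_S_extension X2 Y2 d \<phi>2"
    "coherent X1 Y1 \<phi>1 X2 Y2 \<phi>2 d"
    by (rule coherent_extension[of X1 X2 Y1 \<phi>1]) (use * in simp_all)
  then show "\<exists>Y2 \<phi>2. finite Y2 \<and> Y2 \<subseteq> Y \<and> minimal_S_extension X2 Y2 d \<phi>2 \<and>
      coherent X1 Y1 \<phi>1 X2 Y2 \<phi>2 d"
    by blast
qed

section \<open>Embedding a compact ultrametric space\<close>

lemma (in Ultrametric_space) mball_eq_iff: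
  assumes "x \<in> M" "y \<in> M" "0 < t"
  shows "mball x t = mball y t \<longleftrightarrow> d x y < t"
proof
  show "d x y < t" if "mball x t = mball y t"
  proof -
    have "y \<in> mball y t" using assms by simp
    then show ?thesis using that by auto
  qed
  show "mball x t = mball y t" if xy: "d x y < t"
  proof -
    have "d x z < t \<longleftrightarrow> d y z < t" if "z \<in> M" for z
      using ultrametric[of x y z] ultrametric[of y x z] commute[of x y] assms xy that by auto
    then show ?thesis using assms by auto
  qed
qed

context Ultrametric_space
begin

definition distances :: "real set" where
  "distances = {d x y | x y. x \<in> M \<and> y \<in> M \<and> x \<noteq> y}"

definition balls :: "real \<Rightarrow> 'a set set" where
  "balls t = (\<lambda>x. mball x t) ` M"

text \<open>One numbering serves for all open \<open>t\<close>-balls of the space, not one per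
  closed ball, so the same bound \<open>card (balls t)\<close> applies at every branching.\<close>

definition ball_coord :: "'a \<Rightarrow> real \<Rightarrow> nat" where
  "ball_coord x t = (if t \<in> distances then label (balls t) (mball x t) else 0)"

lemma distances_pos: "t \<in> distances \<Longrightarrow> 0 < t"
  unfolding distances_def using mdist_pos_less by blast

lemma finite_net:
  assumes "mtotally_bounded M" "0 < e"
  obtains K where "finite K" "K \<subseteq> M" "\<And>x. x \<in> M \<Longrightarrow> \<exists>a\<in>K. d a x < e"
proof -
  obtain K where K: "finite K" "K \<subseteq> M" "M \<subseteq> (\<Union>x\<in>K. mball x e)"
    using assms(1)[unfolded mtotally_bounded_def, rule_format, OF assms(2)] by auto
  have "\<exists>a\<in>K. d a x < e" if "x \<in> M" for x
    using subsetD[OF K(3) that] by auto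
  then show ?thesis using that K by blast
qed

text \<open>Moving the endpoints to a finite \<open>e\<close>-net changes no distance of at least
  \<open>e\<close>, so all of these occur between net points.\<close>

lemma finite_large_distances:
  assumes "mtotally_bounded M" "0 < e"
  shows "finite (distances \<inter> {e..})"
proof -
  obtain K where K: "finite K" "K \<subseteq> M" "\<And>x. x \<in> M \<Longrightarrow> \<exists>a\<in>K. d a x < e"
    using finite_net[OF assms] by metis
  have "distances \<inter> {e..} \<subseteq> (\<lambda>(a, b). d a b) ` (K \<times> K)"
  proof
    fix t assume "t \<in> distances \<inter> {e..}"
    then obtain x y where t: "t = d x y" "x \<in> M" "y \<in> M" "e \<le> d x y"
      unfolding distances_def by auto
    obtain a b where ab: "a \<in> K" "d a x < e" "b \<in> K" "d b y < e"
      using K(3) t by blast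
    then have "d a b = t" using dist_perturb[of x y a b e] t K(2) by auto
    then show "t \<in> (\<lambda>(a, b). d a b) ` (K \<times> K)" using ab by force
  qed
  then show ?thesis using K(1) finite_subset by blast
qed

lemma finite_balls:
  assumes "mtotally_bounded M" "0 < t"
  shows "finite (balls t)"
proof -
  obtain K where K: "finite K" "K \<subseteq> M" "\<And>x. x \<in> M \<Longrightarrow> \<exists>a\<in>K. d a x < t"
    using finite_net[OF assms] by metis
  have "balls t \<subseteq> (\<lambda>x. mball x t) ` K"
    unfolding balls_def
  proof
    fix S assume "S \<in> (\<lambda>x. mball x t) ` M"
    then obtain x where x: "x \<in> M" "S = mball x t" by blast
    then obtain a where "a \<in> K" "d a x < t" using K(3) by blast
    then show "S \<in> (\<lambda>x. mball x t) ` K"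
      using mball_eq_iff[of a x t] x K(2) assms(2) by auto
  qed
  then show ?thesis using K(1) finite_subset by blast
qed

lemma ball_coord_cube:
  assumes "mtotally_bounded M" "x \<in> M"
  shows "ball_coord x \<in> cube distances (\<lambda>t. card (balls t))"
proof -
  have "label (balls t) (mball x t) < card (balls t)" if "t \<in> distances" for t
    using bij_betw_label[OF finite_balls[OF assms(1) distances_pos[OF that]]] assms(2)
    by (auto simp: bij_betw_def balls_def)
  then show ?thesis by (simp add: cube_def ball_coord_def)
qed

lemma ball_coord_eq_iff:
  assumes "mtotally_bounded M" "x \<in> M" "y \<in> M" "t \<in> distances"
  shows "ball_coord x t = ball_coord y t \<longleftrightarrow> d x y < t"
proof -
  have "inj_on (label (balls t)) (balls t)"
    using bij_betw_label[OF finite_balls[OF assms(1) distances_pos[OF assms(4)]]]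
    by (simp add: bij_betw_def)
  then have "ball_coord x t = ball_coord y t \<longleftrightarrow> mball x t = mball y t"
    using assms by (auto simp: ball_coord_def balls_def inj_on_eq_iff)
  then show ?thesis using mball_eq_iff distances_pos assms by simp
qed

text \<open>Two points share an open \<open>t\<close>-ball exactly for radii \<open>t\<close> above
  their distance, so their coordinates agree above the distance and differ at it.\<close>

lemma cube_dist_ball_coord:
  assumes bdd: "mtotally_bounded M" and xy: "x \<in> M" "y \<in> M"
  shows "cube_dist (ball_coord x) (ball_coord y) = d x y"
proof (cases "x = y")
  case True
  then show ?thesis using xy by simp
next
  case False
  interpret R: radii distances
    using distances_pos finite_large_distances[OF bdd] by unfold_locales
  note cube = ball_coord_cube[OF bdd xy(1)] ball_coord_cube[OF bdd xy(2)]
  have s: "d x y \<in> distances" using xy False unfolding distances_def by blast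
  have "ball_coord x t = ball_coord y t" if "t > d x y" for t
    using ball_coord_eq_iff[OF bdd xy, of t] that by (cases "t \<in> distances") (simp_all add: ball_coord_def)
  then have "cube_dist (ball_coord x) (ball_coord y) \<le> d x y"
    using R.cube_dist_le_iff[OF cube nonneg] by blast
  moreover have "d x y \<le> cube_dist (ball_coord x) (ball_coord y)"
    using R.cube_dist_ge[OF cube] ball_coord_eq_iff[OF bdd xy s] by blast
  ultimately show ?thesis by simp
qed

end

section \<open>Room for the product in a disjoint sum with the reals\<close>

lemma (in radii) countable: "countable D"
proof -
  have "D \<subseteq> (\<Union>n. D \<inter> {1 / real (Suc n)..})"
  proof
    fix t assume t: "t \<in> D"
    then obtain n where "inverse (real (Suc n)) < t" using reals_Archimedean[OF pos] by blast
    then have "t \<in> D \<inter> {1 / real (Suc n)..}" using t by (simp add: inverse_eq_divide)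
    then show "t \<in> (\<Union>n. D \<inter> {1 / real (Suc n)..})" by blast
  qed
  moreover have "countable (\<Union>n. D \<inter> {1 / real (Suc n)..})"
    by (intro countable_UN countableI_type countable_finite fin) simp
  ultimately show ?thesis using countable_subset by blast
qed

text \<open>New points of \<open>Y\<close> have to be named by reals. As \<open>D\<close> is
  countable, the graph of \<open>f\<close> on \<open>D\<close> is coded by a set of naturals, and
  such sets inject into the reals.\<close>

lemma (in radii) cube_inj_reals: "\<exists>j :: (real \<Rightarrow> nat) \<Rightarrow> real. inj_on j (cube D k)"
proof -
  obtain g :: "nat set \<Rightarrow> real" where g: "inj g"
    using nat_sets_eqpoll_reals unfolding eqpoll_def bij_betw_def by blast
  define G where "G f = (\<lambda>t. prod_encode (to_nat_on D t, f t)) ` D" for f :: "real \<Rightarrow> nat"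
  have "inj_on G (cube D k)"
  proof (rule inj_onI)
    fix f h assume f: "f \<in> cube D k" and h: "h \<in> cube D k" and eq: "G f = G h"
    show "f = h"
    proof
      fix t
      show "f t = h t"
      proof (cases "t \<in> D")
        case True
        then have "prod_encode (to_nat_on D t, f t) \<in> G h" using eq unfolding G_def by blast
        then obtain u where u: "u \<in> D" "prod_encode (to_nat_on D t, f t) = prod_encode (to_nat_on D u, h u)"
          unfolding G_def by blast
        then have "to_nat_on D t = to_nat_on D u" "f t = h u" by simp_all
        moreover from this have "t = u"
          using inj_on_to_nat_on[OF countable] True u(1) by (meson inj_onD)
        ultimately show ?thesis by simp
      qed (use f h in \<open>auto simp: cube_def\<close>)
    qed
  qed
  then have "inj_on (\<lambda>f. g (G f)) (cube D k)" using g unfolding inj_on_def by blast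
  then show ?thesis by blast
qed

text \<open>The left summand keeps \<open>X\<close>, and each point \<open>z\<close> of
  \<open>Z\<close> outside the image of \<open>e\<close> is named by the real \<open>j z\<close> on
  the right.\<close>

lemma adjoin_reals:
  fixes e :: "'a \<Rightarrow> 'c" and j :: "'c \<Rightarrow> real"
  assumes e: "inj_on e X" "e ` X \<subseteq> Z" and j: "inj_on j Z"
  obtains Y :: "('a + real) set" and c where "Inl ` X \<subseteq> Y" "bij_betw c Y Z"
    "\<And>x. x \<in> X \<Longrightarrow> c (Inl x) = e x"
proof -
  define c where "c = case_sum e (inv_into Z j)"
  let ?R = "(Inr \<circ> j) ` (Z - e ` X)"
  have cR: "c (Inr (j z)) = z" if "z \<in> Z" for z using that j by (simp add: c_def)
  have "bij_betw c (Inl ` X) (e ` X)"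
    using e(1) by (simp add: bij_betw_def c_def inj_on_def image_image)
  moreover have "bij_betw c ?R (Z - e ` X)"
    unfolding bij_betw_def
  proof
    show "inj_on c ?R" by (rule inj_onI) (auto simp: cR)
    show "c ` ?R = Z - e ` X" by (force simp: cR image_image)
  qed
  ultimately have "bij_betw c (Inl ` X \<union> ?R) (e ` X \<union> (Z - e ` X))"
    by (rule bij_betw_combine) auto
  moreover have "e ` X \<union> (Z - e ` X) = Z" using e(2) by blast
  ultimately show ?thesis using that[of "Inl ` X \<union> ?R" c] by (simp add: c_def)
qed

section \<open>S-extensions from the extension property\<close>

lemma image_partial_isometry:
  assumes ext: "metric_extension e X d Y d'" and p: "p \<in> partial_isometries X d"
  shows "map_prod e e ` p \<in> partial_isometries Y d'"
  unfolding partial_isometries_iff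
proof (intro conjI allI impI single_valuedI)
  have mY: "Metric_space Y d'" and eY: "\<And>x. x \<in> X \<Longrightarrow> e x \<in> Y"
    and e: "\<And>x y. x \<in> X \<Longrightarrow> y \<in> X \<Longrightarrow> d' (e x) (e y) = d x y"
    using ext unfolding metric_extension_def by blast+
  show "finite (map_prod e e ` p)" using p by (simp add: partial_isometries_iff)
  show "map_prod e e ` p \<subseteq> Y \<times> Y" using partial_isometry_mem[OF p] eY by auto
  show dist: "d' b b' = d' a a'" if "(a, b) \<in> map_prod e e ` p" "(a', b') \<in> map_prod e e ` p" for a b a' b'
  proof -
    obtain x y x' y' where "(x, y) \<in> p" "(x', y') \<in> p" "a = e x" "b = e y" "a' = e x'" "b' = e y'"
      using \<open>(a, b) \<in> _\<close> \<open>(a', b') \<in> _\<close> by auto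
    then show ?thesis
      using partial_isometry_mem[OF p, of x y] partial_isometry_mem[OF p, of x' y']
        partial_isometry_dist[OF p, of x y x' y'] e by simp
  qed
  show "b = b'" if *: "(a, b) \<in> map_prod e e ` p" "(a, b') \<in> map_prod e e ` p" for a b b'
  proof -
    have "a \<in> Y" "b \<in> Y" "b' \<in> Y" using * partial_isometry_mem[OF p] eY by auto
    then show ?thesis using dist[OF *] Metric_space.zero[OF mY] by metis
  qed
qed

text \<open>Clause (i) of ultraextensivity extends the image of each \<open>p\<close> under
  \<open>e\<close>; the extensions are chosen separately for each \<open>p\<close>.\<close>

lemma ultraextensive_S_extension:
  assumes ext: "metric_extension e X d Y d'" and Y: "ultraextensive Y d'"
  shows "\<exists>\<phi>. S_extension e X d Y d' \<phi>"
proof -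
  have U: "\<forall>p\<in>partial_isometries Y d'. \<exists>f\<in>carrier (Iso Y d'). \<forall>(x, y)\<in>p. f x = y"
    using Y unfolding ultraextensive_def by (elim conjE)
  have "\<exists>f. f \<in> carrier (Iso Y d') \<and> (\<forall>(x, y)\<in>p. f (e x) = e y)" if p: "p \<in> PP X d" for p
  proof -
    have "map_prod e e ` p \<in> partial_isometries Y d'"
      using image_partial_isometry[OF ext] p by (simp add: PP_def)
    from bspec[OF U this] obtain f
      where f: "f \<in> carrier (Iso Y d')" "\<forall>(x, y)\<in>map_prod e e ` p. f x = y" by (elim bexE)
    have "\<forall>(x, y)\<in>p. f (e x) = e y" using f(2) by auto
    then show ?thesis using f(1) by blast
  qed
  then have "\<exists>\<phi>. \<forall>p\<in>PP X d. \<phi> p \<in> carrier (Iso Y d') \<and> (\<forall>(x, y)\<in>p. \<phi> p (e x) = e y)"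
    by (intro bchoice ballI)
  then obtain \<phi> where
    "\<forall>p\<in>PP X d. \<phi> p \<in> carrier (Iso Y d') \<and> (\<forall>(x, y)\<in>p. \<phi> p (e x) = e y)" ..
  then have "\<phi> \<in> PP X d \<rightarrow> carrier (Iso Y d')" "\<forall>p\<in>PP X d. \<forall>(x, y)\<in>p. \<phi> p (e x) = e y"
    by simp_all
  then show ?thesis using ext unfolding S_extension_def by blast
qed

theorem theorem7p6:
  fixes X :: "'a set" and d :: "'a \<Rightarrow> 'a \<Rightarrow> real"
  assumes "compact_ultrametric X d"
  shows "(\<exists>(Y :: ('a + real) set) d'.
            compact_ultrametric Y d' \<and> metric_extension Inl X d Y d' \<and> ultraextensive Y d')
       \<and> (\<exists>(Y :: ('a + real) set) d' \<phi>.
            compact_ultrametric Y d' \<and> S_extension Inl X d Y d' \<phi>)"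
proof -
  interpret X: Ultrametric_space X d using assms by (simp add: compact_ultrametric_def)
  have bdd: "X.mtotally_bounded X"
    using assms X.compact_space_eq_mcomplete_mtotally_bounded by (simp add: compact_ultrametric_def)
  let ?D = X.distances and ?k = "\<lambda>t. card (X.balls t)"
  interpret R: radii ?D
    using X.distances_pos X.finite_large_distances[OF bdd] by unfold_locales
  obtain j :: "(real \<Rightarrow> nat) \<Rightarrow> real" where j: "inj_on j (cube ?D ?k)"
    using R.cube_inj_reals by blast
  have inj: "inj_on X.ball_coord X"
  proof (rule inj_onI)
    fix x y assume xy: "x \<in> X" "y \<in> X" "X.ball_coord x = X.ball_coord y"
    then have "d x y = 0" using X.cube_dist_ball_coord[OF bdd xy(1,2)] by simp
    then show "x = y" using xy X.zero by blast
  qed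
  have sub: "X.ball_coord ` X \<subseteq> cube ?D ?k" using X.ball_coord_cube[OF bdd] by blast
  obtain Y :: "('a + real) set" and c where Y: "Inl ` X \<subseteq> Y" "bij_betw c Y (cube ?D ?k)"
    and c: "\<And>x. x \<in> X \<Longrightarrow> c (Inl x) = X.ball_coord x"
    by (rule adjoin_reals[OF inj sub j]) blast
  \<comment> \<open>The metric is pulled back from the cube along \<open>c\<close>; on the copy of
    \<open>X\<close> this is the ball coordinate map, which reproduces \<open>d\<close>.\<close>
  define d' where "d' x y = (if x \<in> Y \<and> y \<in> Y then cube_dist (c x) (c y) else 0)" for x y
  interpret Y: coordinates ?D ?k Y d' c
    using Y(2) by unfold_locales (simp_all add: d'_def)
  have "d' (Inl x) (Inl y) = d x y" if "x \<in> X" "y \<in> X" for x y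
    using that Y(1) c X.cube_dist_ball_coord[OF bdd that] by (auto simp: d'_def)
  then have ext: "metric_extension Inl X d Y d'"
    using Y(1) X.Metric_space_axioms Y.Metric_space_axioms unfolding metric_extension_def by blast
  show ?thesis
    using ext Y.compact_ultrametric Y.ultraextensive
      ultraextensive_S_extension[OF ext Y.ultraextensive] by blast
qed

end
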